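(* Let $(M^\bullet,b,B)$ be a mixed cochain complex over a field $\mathbb{K}$ of characteristic zero, $(\mathfrak{g}^\bullet,\iota,\mathcal{L},\mathcal{S},\mathcal{T})$ a homotopy Cartan-Gerstenhaber calculus on $CC^\bullet_{\mathrm{per}}(M)$, and $\zeta\in M^{-1}$ a Palladio (duality) cocycle. Assume that $H^\bullet(\mathcal{G}_{\mathfrak g})$, $\mathcal{G}_{\mathfrak g}^\bullet=\mathfrak{g}^\bullet[-1]$, is a Gerstenhaber algebra, and let $V^\bullet=H^{\bullet-1}(M)$ carry the transported product $\smile$ and bracket $\{\cdot,\cdot\}$. If $\{\cdot,\cdot\}$ vanishes identically on $V^\bullet$, then $$\{\!\!\{x,y\}\!\!\}:=(-1)^x(Bx)\smile(By)$$ defines a degree $-2$ Lie bracket on $V^\bullet$ such that $j\{\!\!\{x,y\}\!\!\}=[jx,jy]$ and $B\{\!\!\{x,y\}\!\!\}=0$. This bracket turns $(V^\bullet,\smile,\{\!\!\{\cdot,\cdot\}\!\!\})$ into an $e_3$-algebra, i.e. for homogeneous $x,y,z\in V^\bullet$: $$\{\!\!\{x,y\}\!\!\}=-(-1)^{xy}\{\!\!\{y,x\}\!\!\},$$ $$\{\!\!\{x,\{\!\!\{y,z\}\!\!\}\}\!\!\}=\{\!\!\{\{\!\!\{x,y\}\!\!\},z\}\!\!\}+(-1)^{xy}\{\!\!\{y,\{\!\!\{x,z\}\!\!\}\}\!\!\},$$ $$\{\!\!\{x,y\smile z\}\!\!\}=\{\!\!\{x,y\}\!\!\}\smile z+(-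1)^{xy}y\smile\{\!\!\{x,z\}\!\!\}.$$
   Context: Mixed complexes. A mixed cochain complex $(M^\bullet,b,B)$ is a $\mathbb{Z}$-graded $\mathbb{K}$-vector space with $b$ of degree $+1$, $B$ of degree $-1$, $b^2=B^2=0$, $bB+Bb=0$; $H^\bullet(M)$ is the $b$-cohomology and $B$ induces $B\colon H^\bullet(M)\to H^{\bullet-1}(M)$. $V[k]^i=V^{i+k}$. With $u$ of degree $2$, $M[[u,u^{-1}]]^n=\prod_{i+2j=n}M^iu^j$, $d_u=b+uB$; $CC^\bullet_{\mathrm{per}}(M)=(M[[u,u^{-1}]],d_u)$; $CC_-^\bullet(M)$ is its quotient by $uM[[u]]$, with cohomology $HC_-^\bullet(M)$. The short exact sequence $0\to M^\bullet\to CC_-^\bullet(M)\xrightarrow{u}CC_-^\bullet(M)[2]\to0$ (first map: inclusion as constants) gives $\cdots\to H^n(M)\xrightarrow{j}HC_-^n(M)\to HC_-^{n+2}(M)\xrightarrow{\beta}H^{n+1}(M)\to\cdots$, with $\beta[f]=[Bf_0]$, $f_0$ the coefficient of $u^0$. $[P,Q]=PQ-(-1)^{|P||Q|}QP$ for operators. Calculus. Let $(\mathfrak{g}^\bullet,\delta,\{\cdot,\cdot\})$ be a dg-Lie algebra. A homotopy pre-Cartan calculus consists of linear maps $\iota\colon\mathfrak{g}^\bullet\otimes M^\bullet\to M^\bullet[1]$, $\mathcal{L}\colon\mathfrak{g}^\bullet\otimes M^\bullet\to M^\bullet$, $\mathcal{S}\colon\mathfrak{g}^\bullet\otimes M^\bullet\to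 M^\bullet[-1]$ with $\mathcal{L}_f=[B,\iota_f]+[b,\mathcal{S}_f]+\mathcal{S}_{\delta f}$, $[b,\iota_f]+\iota_{\delta f}=0$, $[B,\mathcal{S}_f]=0$. Everything is extended $\mathbb{K}[u,u^{-1}]$-linearly and $\mathcal{I}_f=\iota_f+u\mathcal{S}_f$. A homotopy Cartan calculus has in addition a linear map $\mathcal{T}\colon\mathfrak{g}^\bullet\otimes\mathfrak{g}^\bullet\otimes M^\bullet\to M^\bullet$ with $[\mathcal{I}_f,\mathcal{L}_g]-\mathcal{I}_{\{f,g\}}=[d_u,\mathcal{T}(f,g)]-\mathcal{T}(\delta f,g)-(-1)^f\mathcal{T}(f,\delta g)$. It is a homotopy Cartan-Gerstenhaber calculus if moreover $\mathcal{G}_{\mathfrak g}^\bullet=\mathfrak{g}^\bullet[-1]$ (so $\mathcal{G}^n_{\mathfrak g}=\mathfrak{g}^{n-1}$) carries a unital associative (not necessarily commutative) degree-$0$ product $\smile$ for which $\delta$ is a graded derivation, with $\iota_{f\smile g}=\iota_f\iota_g$ and $\iota_1=\mathrm{id}$. Palladio cocycle. $\zeta\in M^{-1}$ with (i) $b\zeta=0$; (ii) $B\zeta=b\eta$ for some $\eta\in M^{-3}$; (iii) $\mathfrak{g}^\bullet\to M^\bullet$, $f\mapsto(-1)^f\iota_f\zeta$ ($f$ in the sign: degree in $\mathfrak g$), is a quasi-isomorphism, inducing $p_\zeta\colon H^\bullet(\mathfrak{g})\cong H^\bullet(M)$. On $H^\bullet(M)$ put $a\smile b=p_\zeta(p_\zeta^{-1}a\smile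 p_\zeta^{-1}b)$ and $\{a,b\}=p_\zeta\{p_\zeta^{-1}a,p_\zeta^{-1}b\}$. Gradings. $V^n=H^{n-1}(M)$; in all signs of the claim, $x,y$ denote degrees in $V^\bullet$. Likewise $HC_-^{n-1}(M)$ is placed in degree $n$, and the Chas-Sullivan-Menichi bracket on it is $[x,y]=(-1)^xj((\beta x)\smile(\beta y))$ with this shifted degree in the sign. A Gerstenhaber algebra is a graded vector space with a graded commutative associative product $\smile$ of degree $0$ and a bracket $\{\cdot,\cdot\}$ of degree $-1$ that is a graded Lie bracket after shifting degrees by one, with $\{f,g\smile h\}=\{f,g\}\smile h+(-1)^{(f-1)g}g\smile\{f,h\}$. *)

theory Defs
  imports Complex_Main "HOL-Algebra.Module" "HOL-Library.Function_Algebras"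
begin

text \<open>
  A complex is a family of subspaces of one ambient vector space (of type \<open>'a\<close>) together with a
  globally defined differential. The input data (mixed complex, dg-Lie algebra) are required to be
  internally graded, i.e. the ambient space is the direct sum of the homogeneous pieces, so that
  linear operators are the library's linear maps on the whole type. For the product total complex
  \<open>CCper\<close> below no such requirement is made.
\<close>

record ('k, 'a) cochain_complex =
  scl :: "'k \<Rightarrow> 'a \<Rightarrow> 'a"
  spc :: "int \<Rightarrow> 'a set"
  dif :: "'a \<Rightarrow> 'a"

definition graded_space :: "('k::field \<Rightarrow> 'a::ab_group_add \<Rightarrow> 'a) \<Rightarrow> (int \<Rightarrow> 'a set) \<Rightarrow> bool" where
  "graded_space s A \<longleftrightarrow>
     vector_space s \<and> (\<forall>n. Modules.module.subspace s (A n)) \<and>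
     (\<forall>x. \<exists>!c. (\<forall>n. c n \<in> A n) \<and> finite {n. c n \<noteq> 0} \<and> x = (\<Sum>n | c n \<noteq> 0. c n))"

definition cochain_complex :: "('k::field, 'a::ab_group_add, 'z) cochain_complex_scheme \<Rightarrow> bool" where
  "cochain_complex C \<longleftrightarrow>
     graded_space (scl C) (spc C) \<and> Vector_Spaces.linear (scl C) (scl C) (dif C) \<and>
     (\<forall>n. \<forall>x\<in>spc C n. dif C x \<in> spc C (n + 1)) \<and> (\<forall>x. dif C (dif C x) = 0)"

definition bilin ::
  "('k::field \<Rightarrow> 'a::ab_group_add \<Rightarrow> 'a) \<Rightarrow> ('k \<Rightarrow> 'b::ab_group_add \<Rightarrow> 'b) \<Rightarrow>
   ('k \<Rightarrow> 'c::ab_group_add \<Rightarrow> 'c) \<Rightarrow> ('a \<Rightarrow> 'b \<Rightarrow> 'c) \<Rightarrow> bool" where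
  "bilin s\<^sub>1 s\<^sub>2 s\<^sub>3 f \<longleftrightarrow>
     (\<forall>x. Vector_Spaces.linear s\<^sub>2 s\<^sub>3 (f x)) \<and> (\<forall>y. Vector_Spaces.linear s\<^sub>1 s\<^sub>3 (\<lambda>x. f x y))"

text \<open>Graded commutator \<open>[P,Q]\<close> of operators of degrees \<open>p\<close> and \<open>q\<close>; \<open>s\<close> is the scalar action.\<close>

definition gcomm ::
  "('k::field \<Rightarrow> 'a::ab_group_add \<Rightarrow> 'a) \<Rightarrow> int \<Rightarrow> int \<Rightarrow> ('a \<Rightarrow> 'a) \<Rightarrow> ('a \<Rightarrow> 'a) \<Rightarrow> 'a \<Rightarrow> 'a" where
  "gcomm s p q P Q = (\<lambda>x. P (Q x) - s ((- 1) powi (p * q)) (Q (P x)))"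


section \<open>Cohomology\<close>

text \<open>
  Cohomology spaces are quotient spaces whose elements are cosets; they are packaged as modules in
  the sense of \<open>HOL-Algebra\<close> over the field \<open>'k\<close>. The ring fields \<open>mult\<close> and \<open>one\<close> of the module
  record have no meaning here. Maps on quotients are given by the union of the cosets of the images
  of all representatives, which is a single coset whenever the map is well defined.
\<close>

definition field_ring :: "'k::field ring" where
  "field_ring = \<lparr>carrier = UNIV, mult = (*), one = 1, zero = 0, add = (+)\<rparr>"

definition class_mod :: "'a::ab_group_add set \<Rightarrow> 'a \<Rightarrow> 'a set" where
  "class_mod W x = {x + w | w. w \<in> W}"

definition quot_space ::
  "('k::field \<Rightarrow> 'a::ab_group_add \<Rightarrow> 'a) \<Rightarrow> 'a set \<Rightarrow> 'a set \<Rightarrow> ('k, 'a set) module" where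
  "quot_space s Z W =
     \<lparr>carrier = class_mod W ` Z, mult = undefined, one = undefined,
      zero = class_mod W 0,
      add = (\<lambda>X Y. \<Union>x\<in>X. \<Union>y\<in>Y. class_mod W (x + y)),
      smult = (\<lambda>c X. \<Union>x\<in>X. class_mod W (s c x))\<rparr>"

definition induced :: "'b::ab_group_add set \<Rightarrow> ('a \<Rightarrow> 'b) \<Rightarrow> 'a set \<Rightarrow> 'b set" where
  "induced W \<phi> X = (\<Union>x\<in>X. class_mod W (\<phi> x))"

definition induced2 :: "'c::ab_group_add set \<Rightarrow> ('a \<Rightarrow> 'b \<Rightarrow> 'c) \<Rightarrow> 'a set \<Rightarrow> 'b set \<Rightarrow> 'c set" where
  "induced2 W \<phi> X Y = (\<Union>x\<in>X. \<Union>y\<in>Y. class_mod W (\<phi> x y))"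

definition cocycles :: "('k::field, 'a::ab_group_add, 'z) cochain_complex_scheme \<Rightarrow> int \<Rightarrow> 'a set" where
  "cocycles C n = {x \<in> spc C n. dif C x = 0}"

definition coboundaries :: "('k::field, 'a::ab_group_add, 'z) cochain_complex_scheme \<Rightarrow> int \<Rightarrow> 'a set" where
  "coboundaries C n = dif C ` spc C (n - 1)"

definition cohomology ::
  "('k::field, 'a::ab_group_add, 'z) cochain_complex_scheme \<Rightarrow> int \<Rightarrow> ('k, 'a set) module" where
  "cohomology C n = quot_space (scl C) (cocycles C n) (coboundaries C n)"

text \<open>
  Cohomology of the quotient of \<open>C\<close> by a subcomplex \<open>F\<close>. By the third isomorphism theorem a class
  of \<open>C/F\<close> is presented directly as a coset in \<open>C\<close>: a cocycle of \<open>C/F\<close> is an \<open>x\<close> with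
  \<open>d x \<in> F\<close>, and it is a coboundary of \<open>C/F\<close> if \<open>x \<in> d C + F\<close>.
\<close>

definition quot_cocycles ::
  "('k::field, 'a::ab_group_add, 'z) cochain_complex_scheme \<Rightarrow> (int \<Rightarrow> 'a set) \<Rightarrow> int \<Rightarrow> 'a set" where
  "quot_cocycles C F n = {x \<in> spc C n. dif C x \<in> F (n + 1)}"

definition quot_coboundaries ::
  "('k::field, 'a::ab_group_add, 'z) cochain_complex_scheme \<Rightarrow> (int \<Rightarrow> 'a set) \<Rightarrow> int \<Rightarrow> 'a set" where
  "quot_coboundaries C F n = {dif C y + w | y w. y \<in> spc C (n - 1) \<and> w \<in> F n}"

definition quot_cohomology ::
  "('k::field, 'a::ab_group_add, 'z) cochain_complex_scheme \<Rightarrow> (int \<Rightarrow> 'a set) \<Rightarrow> int \<Rightarrow>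
   ('k, 'a set) module" where
  "quot_cohomology C F n = quot_space (scl C) (quot_cocycles C F n) (quot_coboundaries C F n)"

definition quasi_iso ::
  "('k::field, 'a::ab_group_add, 'y) cochain_complex_scheme \<Rightarrow>
   ('k, 'b::ab_group_add, 'z) cochain_complex_scheme \<Rightarrow> (int \<Rightarrow> 'a \<Rightarrow> 'b) \<Rightarrow> bool" where
  "quasi_iso C D \<phi> \<longleftrightarrow>
     (\<forall>n. Vector_Spaces.linear (scl C) (scl D) (\<phi> n)) \<and>
     (\<forall>n. \<forall>x\<in>spc C n. \<phi> n x \<in> spc D n \<and> \<phi> (n + 1) (dif C x) = dif D (\<phi> n x)) \<and>
     (\<forall>n. bij_betw (induced (coboundaries D n) (\<phi> n))
             (carrier (cohomology C n)) (carrier (cohomology D n)))"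


section \<open>Mixed complexes\<close>

record ('k, 'a) mixed_complex = "('k, 'a) cochain_complex" +
  Bop :: "'a \<Rightarrow> 'a"

definition mixed_complex :: "('k::field, 'm::ab_group_add) mixed_complex \<Rightarrow> bool" where
  "mixed_complex M \<longleftrightarrow>
     cochain_complex M \<and> Vector_Spaces.linear (scl M) (scl M) (Bop M) \<and>
     (\<forall>n. \<forall>x\<in>spc M n. Bop M x \<in> spc M (n - 1)) \<and>
     (\<forall>x. Bop M (Bop M x) = 0) \<and>
     (\<forall>x. dif M (Bop M x) + Bop M (dif M x) = 0)"

text \<open>
  An element of \<open>M[[u,u\<inverse>]]\<close> is the function sending \<open>j\<close> to its coefficient of \<open>u\<^sup>j\<close>.
  An operator \<open>P\<close> on \<open>M\<close> extends \<open>u\<close>-linearly to \<open>uext P\<close>.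
\<close>

definition uext :: "('m \<Rightarrow> 'm) \<Rightarrow> (int \<Rightarrow> 'm) \<Rightarrow> int \<Rightarrow> 'm" where
  "uext P h = (\<lambda>j. P (h j))"

definition umul :: "(int \<Rightarrow> 'm) \<Rightarrow> int \<Rightarrow> 'm" where
  "umul h = (\<lambda>j. h (j - 1))"

definition CCper :: "('k::field, 'm::ab_group_add) mixed_complex \<Rightarrow> ('k, int \<Rightarrow> 'm) cochain_complex" where
  "CCper M =
     \<lparr>scl = (\<lambda>c. uext (scl M c)),
      spc = (\<lambda>n. {h. \<forall>j. h j \<in> spc M (n - 2 * j)}),
      dif = (\<lambda>h. uext (dif M) h + umul (uext (Bop M) h))\<rparr>"

text \<open>The subcomplex \<open>u M[[u]]\<close>; the negative cyclic complex is the quotient of \<open>CCper\<close> by it.\<close>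

definition uMu :: "('k::field, 'm::ab_group_add) mixed_complex \<Rightarrow> int \<Rightarrow> (int \<Rightarrow> 'm) set" where
  "uMu M n = {h \<in> spc (CCper M) n. \<forall>j\<le>0. h j = 0}"

definition HCneg ::
  "('k::field, 'm::ab_group_add) mixed_complex \<Rightarrow> int \<Rightarrow> ('k, (int \<Rightarrow> 'm) set) module" where
  "HCneg M n = quot_cohomology (CCper M) (uMu M) n"

text \<open>\<open>Bcoh M n : H\<^sup>n(M) \<rightarrow> H\<^sup>n\<^sup>-\<^sup>1(M)\<close>, \<open>jmap M n : H\<^sup>n(M) \<rightarrow> HC\<^sub>-\<^sup>n(M)\<close>,
  \<open>betamap M n : HC\<^sub>-\<^sup>n(M) \<rightarrow> H\<^sup>n\<^sup>-\<^sup>1(M)\<close>.\<close>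

definition Bcoh :: "('k::field, 'm::ab_group_add) mixed_complex \<Rightarrow> int \<Rightarrow> 'm set \<Rightarrow> 'm set" where
  "Bcoh M n = induced (coboundaries M (n - 1)) (Bop M)"

definition jmap :: "('k::field, 'm::ab_group_add) mixed_complex \<Rightarrow> int \<Rightarrow> 'm set \<Rightarrow> (int \<Rightarrow> 'm) set" where
  "jmap M n = induced (quot_coboundaries (CCper M) (uMu M) n) (\<lambda>x j. if j = 0 then x else 0)"

definition betamap :: "('k::field, 'm::ab_group_add) mixed_complex \<Rightarrow> int \<Rightarrow> (int \<Rightarrow> 'm) set \<Rightarrow> 'm set" where
  "betamap M n = induced (coboundaries M (n - 1)) (\<lambda>h. Bop M (h 0))"


section \<open>Calculi\<close>

record ('k, 'a) dg_lie_algebra = "('k, 'a) cochain_complex" +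
  brk :: "'a \<Rightarrow> 'a \<Rightarrow> 'a"

definition dg_lie_algebra :: "('k::field, 'g::ab_group_add) dg_lie_algebra \<Rightarrow> bool" where
  "dg_lie_algebra L \<longleftrightarrow>
     cochain_complex L \<and> bilin (scl L) (scl L) (scl L) (brk L) \<and>
     (\<forall>p q. \<forall>f\<in>spc L p. \<forall>g\<in>spc L q.
        brk L f g \<in> spc L (p + q) \<and>
        brk L f g = - scl L ((- 1) powi (p * q)) (brk L g f) \<and>
        dif L (brk L f g) = brk L (dif L f) g + scl L ((- 1) powi p) (brk L f (dif L g))) \<and>
     (\<forall>p q r. \<forall>f\<in>spc L p. \<forall>g\<in>spc L q. \<forall>h\<in>spc L r.
        brk L f (brk L g h) =
          brk L (brk L f g) h + scl L ((- 1) powi (p * q)) (brk L g (brk L f h)))"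

record ('g, 'm) calculus =
  iop :: "'g \<Rightarrow> 'm \<Rightarrow> 'm"
  Lop :: "'g \<Rightarrow> 'm \<Rightarrow> 'm"
  Sop :: "'g \<Rightarrow> 'm \<Rightarrow> 'm"
  Top :: "'g \<Rightarrow> 'g \<Rightarrow> 'm \<Rightarrow> 'm"
  cup :: "'g \<Rightarrow> 'g \<Rightarrow> 'g"
  unt :: 'g

definition homotopy_pre_cartan_calculus ::
  "('k::field, 'g::ab_group_add) dg_lie_algebra \<Rightarrow> ('k, 'm::ab_group_add) mixed_complex \<Rightarrow>
   ('g, 'm) calculus \<Rightarrow> bool" where
  "homotopy_pre_cartan_calculus L M C \<longleftrightarrow>
     bilin (scl L) (scl M) (scl M) (iop C) \<and>
     bilin (scl L) (scl M) (scl M) (Lop C) \<and>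
     bilin (scl L) (scl M) (scl M) (Sop C) \<and>
     (\<forall>p q. \<forall>f\<in>spc L p. \<forall>m\<in>spc M q.
        iop C f m \<in> spc M (p + q + 1) \<and> Lop C f m \<in> spc M (p + q) \<and> Sop C f m \<in> spc M (p + q - 1)) \<and>
     (\<forall>p. \<forall>f\<in>spc L p. \<forall>m.
        Lop C f m = gcomm (scl M) (- 1) (p + 1) (Bop M) (iop C f) m
                  + gcomm (scl M) 1 (p - 1) (dif M) (Sop C f) m + Sop C (dif L f) m \<and>
        gcomm (scl M) 1 (p + 1) (dif M) (iop C f) m + iop C (dif L f) m = 0 \<and>
        gcomm (scl M) (- 1) (p - 1) (Bop M) (Sop C f) m = 0)"

definition Iop :: "('g, 'm::ab_group_add) calculus \<Rightarrow> 'g \<Rightarrow> (int \<Rightarrow> 'm) \<Rightarrow> int \<Rightarrow> 'm" where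
  "Iop C f h = uext (iop C f) h + umul (uext (Sop C f) h)"

definition homotopy_cartan_calculus ::
  "('k::field, 'g::ab_group_add) dg_lie_algebra \<Rightarrow> ('k, 'm::ab_group_add) mixed_complex \<Rightarrow>
   ('g, 'm) calculus \<Rightarrow> bool" where
  "homotopy_cartan_calculus L M C \<longleftrightarrow>
     homotopy_pre_cartan_calculus L M C \<and>
     (\<forall>f. bilin (scl L) (scl M) (scl M) (Top C f)) \<and>
     (\<forall>g m. Vector_Spaces.linear (scl L) (scl M) (\<lambda>f. Top C f g m)) \<and>
     (\<forall>p q r. \<forall>f\<in>spc L p. \<forall>g\<in>spc L q. \<forall>m\<in>spc M r. Top C f g m \<in> spc M (p + q + r)) \<and>
     (\<forall>p q n. \<forall>f\<in>spc L p. \<forall>g\<in>spc L q. \<forall>h\<in>spc (CCper M) n.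
        gcomm (scl (CCper M)) (p + 1) q (Iop C f) (uext (Lop C g)) h - Iop C (brk L f g) h
        = gcomm (scl (CCper M)) 1 (p + q) (dif (CCper M)) (uext (Top C f g)) h
          - uext (Top C (dif L f) g) h
          - scl (CCper M) ((- 1) powi p) (uext (Top C f (dif L g)) h))"

text \<open>
  The product has degree 0 for the grading \<open>\<G>\<^sup>n = \<gg>\<^sup>n\<^sup>-\<^sup>1\<close>, hence degree 1 for that of \<open>\<gg>\<close>;
  the Koszul sign in the derivation property uses the degree \<open>p + 1\<close> of \<open>f \<in> \<gg>\<^sup>p\<close> in \<open>\<G>\<close>.
\<close>

definition homotopy_cartan_gerstenhaber_calculus ::
  "('k::field, 'g::ab_group_add) dg_lie_algebra \<Rightarrow> ('k, 'm::ab_group_add) mixed_complex \<Rightarrow>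
   ('g, 'm) calculus \<Rightarrow> bool" where
  "homotopy_cartan_gerstenhaber_calculus L M C \<longleftrightarrow>
     homotopy_cartan_calculus L M C \<and>
     bilin (scl L) (scl L) (scl L) (cup C) \<and>
     (\<forall>p q. \<forall>f\<in>spc L p. \<forall>g\<in>spc L q.
        cup C f g \<in> spc L (p + q + 1) \<and>
        dif L (cup C f g) = cup C (dif L f) g + scl L ((- 1) powi (p + 1)) (cup C f (dif L g))) \<and>
     (\<forall>f g h. cup C (cup C f g) h = cup C f (cup C g h)) \<and>
     unt C \<in> spc L (- 1) \<and> (\<forall>f. cup C (unt C) f = f \<and> cup C f (unt C) = f) \<and>
     (\<forall>f g m. iop C (cup C f g) m = iop C f (iop C g m)) \<and>
     (\<forall>m. iop C (unt C) m = m)"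

definition zeta_map ::
  "('k::field, 'm::ab_group_add) mixed_complex \<Rightarrow> ('g, 'm) calculus \<Rightarrow> 'm \<Rightarrow> int \<Rightarrow> 'g \<Rightarrow> 'm" where
  "zeta_map M C \<zeta> n f = scl M ((- 1) powi n) (iop C f \<zeta>)"

definition palladio_cocycle ::
  "('k::field, 'g::ab_group_add) dg_lie_algebra \<Rightarrow> ('k, 'm::ab_group_add) mixed_complex \<Rightarrow>
   ('g, 'm) calculus \<Rightarrow> 'm \<Rightarrow> bool" where
  "palladio_cocycle L M C \<zeta> \<longleftrightarrow>
     \<zeta> \<in> spc M (- 1) \<and> dif M \<zeta> = 0 \<and> (\<exists>\<eta>\<in>spc M (- 3). Bop M \<zeta> = dif M \<eta>) \<and>
     quasi_iso L M (zeta_map M C \<zeta>)"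


section \<open>Gerstenhaber and e3-algebras\<close>

text \<open>
  Here a graded vector space is a family of vector spaces indexed by the degree, and operations
  are indexed by the degrees of their arguments.
\<close>

type_synonym ('k, 'v) graded_vs = "int \<Rightarrow> ('k, 'v) module"
type_synonym 'v graded_op = "int \<Rightarrow> int \<Rightarrow> 'v \<Rightarrow> 'v \<Rightarrow> 'v"

definition graded_bilinear :: "('k::field, 'v) graded_vs \<Rightarrow> int \<Rightarrow> 'v graded_op \<Rightarrow> bool" where
  "graded_bilinear V d m \<longleftrightarrow>
     (\<forall>p q. \<forall>x\<in>carrier (V p). \<forall>y\<in>carrier (V q). m p q x y \<in> carrier (V (p + q + d))) \<and>
     (\<forall>p q. \<forall>x\<in>carrier (V p). \<forall>x'\<in>carrier (V p). \<forall>y\<in>carrier (V q).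
        m p q (x \<oplus>\<^bsub>V p\<^esub> x') y = m p q x y \<oplus>\<^bsub>V (p + q + d)\<^esub> m p q x' y) \<and>
     (\<forall>p q. \<forall>x\<in>carrier (V p). \<forall>y\<in>carrier (V q). \<forall>y'\<in>carrier (V q).
        m p q x (y \<oplus>\<^bsub>V q\<^esub> y') = m p q x y \<oplus>\<^bsub>V (p + q + d)\<^esub> m p q x y') \<and>
     (\<forall>p q c. \<forall>x\<in>carrier (V p). \<forall>y\<in>carrier (V q).
        m p q (c \<odot>\<^bsub>V p\<^esub> x) y = c \<odot>\<^bsub>V (p + q + d)\<^esub> m p q x y \<and>
        m p q x (c \<odot>\<^bsub>V q\<^esub> y) = c \<odot>\<^bsub>V (p + q + d)\<^esub> m p q x y)"

definition graded_comm_algebra :: "('k::field, 'v) graded_vs \<Rightarrow> 'v graded_op \<Rightarrow> bool" where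
  "graded_comm_algebra V m \<longleftrightarrow>
     (\<forall>n. Module.module field_ring (V n)) \<and> graded_bilinear V 0 m \<and>
     (\<forall>p q. \<forall>x\<in>carrier (V p). \<forall>y\<in>carrier (V q).
        m p q x y = (- 1) powi (p * q) \<odot>\<^bsub>V (p + q)\<^esub> m q p y x) \<and>
     (\<forall>p q r. \<forall>x\<in>carrier (V p). \<forall>y\<in>carrier (V q). \<forall>z\<in>carrier (V r).
        m (p + q) r (m p q x y) z = m p (q + r) x (m q r y z))"

definition gerstenhaber_algebra ::
  "('k::field, 'v) graded_vs \<Rightarrow> 'v graded_op \<Rightarrow> 'v graded_op \<Rightarrow> bool" where
  "gerstenhaber_algebra V m br \<longleftrightarrow>
     graded_comm_algebra V m \<and> graded_bilinear V (- 1) br \<and>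
     (\<forall>p q. \<forall>x\<in>carrier (V p). \<forall>y\<in>carrier (V q).
        br p q x y = \<ominus>\<^bsub>V (p + q - 1)\<^esub> ((- 1) powi ((p - 1) * (q - 1)) \<odot>\<^bsub>V (p + q - 1)\<^esub> br q p y x)) \<and>
     (\<forall>p q r. \<forall>x\<in>carrier (V p). \<forall>y\<in>carrier (V q). \<forall>z\<in>carrier (V r).
        br p (q + r - 1) x (br q r y z) =
          br (p + q - 1) r (br p q x y) z \<oplus>\<^bsub>V (p + q + r - 2)\<^esub>
          (- 1) powi ((p - 1) * (q - 1)) \<odot>\<^bsub>V (p + q + r - 2)\<^esub> br q (p + r - 1) y (br p r x z)) \<and>
     (\<forall>p q r. \<forall>x\<in>carrier (V p). \<forall>y\<in>carrier (V q). \<forall>z\<in>carrier (V r).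
        br p (q + r) x (m q r y z) =
          m (p + q - 1) r (br p q x y) z \<oplus>\<^bsub>V (p + q + r - 1)\<^esub>
          (- 1) powi ((p - 1) * q) \<odot>\<^bsub>V (p + q + r - 1)\<^esub> m q (p + r - 1) y (br p r x z))"

text \<open>Degree \<open>-2\<close> Lie bracket: since the shift is even, the signs involve the unshifted degrees.\<close>

definition lie_bracket_deg_minus_2 :: "('k::field, 'v) graded_vs \<Rightarrow> 'v graded_op \<Rightarrow> bool" where
  "lie_bracket_deg_minus_2 V br \<longleftrightarrow>
     graded_bilinear V (- 2) br \<and>
     (\<forall>p q. \<forall>x\<in>carrier (V p). \<forall>y\<in>carrier (V q).
        br p q x y = \<ominus>\<^bsub>V (p + q - 2)\<^esub> ((- 1) powi (p * q) \<odot>\<^bsub>V (p + q - 2)\<^esub> br q p y x)) \<and>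
     (\<forall>p q r. \<forall>x\<in>carrier (V p). \<forall>y\<in>carrier (V q). \<forall>z\<in>carrier (V r).
        br p (q + r - 2) x (br q r y z) =
          br (p + q - 2) r (br p q x y) z \<oplus>\<^bsub>V (p + q + r - 4)\<^esub>
          (- 1) powi (p * q) \<odot>\<^bsub>V (p + q + r - 4)\<^esub> br q (p + r - 2) y (br p r x z))"

definition e3_algebra ::
  "('k::field, 'v) graded_vs \<Rightarrow> 'v graded_op \<Rightarrow> 'v graded_op \<Rightarrow> bool" where
  "e3_algebra V m br \<longleftrightarrow>
     graded_comm_algebra V m \<and> lie_bracket_deg_minus_2 V br \<and>
     (\<forall>p q r. \<forall>x\<in>carrier (V p). \<forall>y\<in>carrier (V q). \<forall>z\<in>carrier (V r).
        br p (q + r) x (m q r y z) =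
          m (p + q - 2) r (br p q x y) z \<oplus>\<^bsub>V (p + q + r - 2)\<^esub>
          (- 1) powi (p * q) \<odot>\<^bsub>V (p + q + r - 2)\<^esub> m q (p + r - 2) y (br p r x z))"


section \<open>The structures in cohomology\<close>

text \<open>
  \<open>shifted C n = H\<^sup>n\<^sup>-\<^sup>1(C)\<close>: for \<open>C = \<gg>\<close> this is \<open>H\<^sup>n(\<G>)\<close>, for \<open>C = M\<close> it is \<open>V\<^sup>n\<close>. All degree
  arguments \<open>p\<close>, \<open>q\<close> of the operations below are degrees in the shifted grading; for instance
  \<open>cupG L C p q\<close> maps \<open>H\<^sup>p\<^sup>-\<^sup>1(\<gg>) \<times> H\<^sup>q\<^sup>-\<^sup>1(\<gg>)\<close> to \<open>H\<^sup>p\<^sup>+\<^sup>q\<^sup>-\<^sup>1(\<gg>)\<close>.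
\<close>

definition shifted :: "('k::field, 'a::ab_group_add, 'z) cochain_complex_scheme \<Rightarrow> ('k, 'a set) graded_vs" where
  "shifted C n = cohomology C (n - 1)"

definition cupG ::
  "('k::field, 'g::ab_group_add) dg_lie_algebra \<Rightarrow> ('g, 'm) calculus \<Rightarrow> 'g set graded_op" where
  "cupG L C p q = induced2 (coboundaries L (p + q - 1)) (cup C)"

definition brkG :: "('k::field, 'g::ab_group_add) dg_lie_algebra \<Rightarrow> 'g set graded_op" where
  "brkG L p q = induced2 (coboundaries L (p + q - 2)) (brk L)"

definition pmap ::
  "('k::field, 'm::ab_group_add) mixed_complex \<Rightarrow> ('g, 'm) calculus \<Rightarrow> 'm \<Rightarrow>
   int \<Rightarrow> 'g set \<Rightarrow> 'm set" where
  "pmap M C \<zeta> p = induced (coboundaries M (p - 1)) (zeta_map M C \<zeta> (p - 1))"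

definition pinv ::
  "('k::field, 'g::ab_group_add) dg_lie_algebra \<Rightarrow> ('k, 'm::ab_group_add) mixed_complex \<Rightarrow>
   ('g, 'm) calculus \<Rightarrow> 'm \<Rightarrow> int \<Rightarrow> 'm set \<Rightarrow> 'g set" where
  "pinv L M C \<zeta> p = inv_into (carrier (shifted L p)) (pmap M C \<zeta> p)"

definition cupV ::
  "('k::field, 'g::ab_group_add) dg_lie_algebra \<Rightarrow> ('k, 'm::ab_group_add) mixed_complex \<Rightarrow>
   ('g, 'm) calculus \<Rightarrow> 'm \<Rightarrow> 'm set graded_op" where
  "cupV L M C \<zeta> p q x y =
     pmap M C \<zeta> (p + q) (cupG L C p q (pinv L M C \<zeta> p x) (pinv L M C \<zeta> q y))"

definition brkV ::
  "('k::field, 'g::ab_group_add) dg_lie_algebra \<Rightarrow> ('k, 'm::ab_group_add) mixed_complex \<Rightarrow>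
   ('g, 'm) calculus \<Rightarrow> 'm \<Rightarrow> 'm set graded_op" where
  "brkV L M C \<zeta> p q x y =
     pmap M C \<zeta> (p + q - 1) (brkG L p q (pinv L M C \<zeta> p x) (pinv L M C \<zeta> q y))"

text \<open>\<open>BV : V\<^sup>p \<rightarrow> V\<^sup>p\<^sup>-\<^sup>1\<close>; \<open>jV\<close> and \<open>betaV\<close> relate \<open>V\<close> and \<open>HCshift M p = HC\<^sub>-\<^sup>p\<^sup>-\<^sup>1(M)\<close>,
  \<open>jV\<close> having degree 0 and \<open>betaV\<close> degree \<open>-1\<close>.\<close>

definition BV :: "('k::field, 'm::ab_group_add) mixed_complex \<Rightarrow> int \<Rightarrow> 'm set \<Rightarrow> 'm set" where
  "BV M p = Bcoh M (p - 1)"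

definition HCshift ::
  "('k::field, 'm::ab_group_add) mixed_complex \<Rightarrow> ('k, (int \<Rightarrow> 'm) set) graded_vs" where
  "HCshift M p = HCneg M (p - 1)"

definition jV :: "('k::field, 'm::ab_group_add) mixed_complex \<Rightarrow> int \<Rightarrow> 'm set \<Rightarrow> (int \<Rightarrow> 'm) set" where
  "jV M p = jmap M (p - 1)"

definition betaV :: "('k::field, 'm::ab_group_add) mixed_complex \<Rightarrow> int \<Rightarrow> (int \<Rightarrow> 'm) set \<Rightarrow> 'm set" where
  "betaV M p = betamap M (p - 1)"

text \<open>The Chas-Sullivan-Menichi bracket on negative cyclic cohomology.\<close>

definition csm_bracket ::
  "('k::field, 'g::ab_group_add) dg_lie_algebra \<Rightarrow> ('k, 'm::ab_group_add) mixed_complex \<Rightarrow>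
   ('g, 'm) calculus \<Rightarrow> 'm \<Rightarrow> (int \<Rightarrow> 'm) set graded_op" where
  "csm_bracket L M C \<zeta> p q x y =
     (- 1) powi p \<odot>\<^bsub>HCshift M (p + q - 2)\<^esub>
       jV M (p + q - 2) (cupV L M C \<zeta> (p - 1) (q - 1) (betaV M p x) (betaV M q y))"

definition e3_bracket ::
  "('k::field, 'g::ab_group_add) dg_lie_algebra \<Rightarrow> ('k, 'm::ab_group_add) mixed_complex \<Rightarrow>
   ('g, 'm) calculus \<Rightarrow> 'm \<Rightarrow> 'm set graded_op" where
  "e3_bracket L M C \<zeta> p q x y =
     (- 1) powi p \<odot>\<^bsub>shifted M (p + q - 2)\<^esub>
       cupV L M C \<zeta> (p - 1) (q - 1) (BV M p x) (BV M q y)"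

end

theory Submission
  imports Defs
begin

text \<open>
  The coefficient of \<open>u\<^sup>0\<close> in the homotopy formula for \<open>[\<I>\<^sub>f, \<L>\<^sub>g] - \<I>\<^bsub>{f,g}\<^esub>\<close>, applied to \<open>\<zeta>\<close>,
  is the BV identity: up to sign, the transported bracket is the failure of \<open>B\<close> to be a graded
  derivation of the product on \<open>V\<close> (here \<open>B\<zeta>\<close> being exact removes the terms containing \<open>B\<zeta>\<close>).
  If the bracket vanishes, \<open>B\<close> is therefore a derivation, and \<open>B\<^sup>2 = 0\<close> then gives
  \<open>B((Bx) \<smile> (By)) = 0\<close>. So every term of the Jacobi identity of \<open>(-1)\<^sup>x(Bx) \<smile> (By)\<close> vanishes,
  and its Leibniz rule is the derivation property of \<open>B\<close>. The compatibility with \<open>j\<close> is \<open>\<beta>j = B\<close>.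
\<close>

section \<open>Quotient spaces\<close>

text \<open>Turns a sign into a case split on the parity of its exponent; the sign identities below
  are settled by such splits.\<close>

lemma minus_one_powi: "(- 1 :: 'k::field) powi n = (if even n then 1 else - 1)"
  using power_int_minus_left[of "1::'k" n] by simp

lemma field_ring_simps [simp]:
  "carrier field_ring = UNIV" "add field_ring = (+)" "zero field_ring = 0"
  "mult field_ring = (*)" "one field_ring = 1"
  by (simp_all add: field_ring_def)

lemma cring_field_ring: "cring (field_ring :: 'k::field ring)"
proof -
  have "abelian_group (field_ring :: 'k ring)"
    by (rule abelian_groupI) (auto intro: exI[of _ "- _"] simp: add_eq_0_iff)
  moreover have "Group.comm_monoid (field_ring :: 'k ring)"
    by (rule comm_monoidI) auto
  ultimately show ?thesis
    by (intro cringI) (auto simp: distrib_right)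
qed

lemma class_mod_eq_iff:
  assumes "vector_space s" and "Modules.module.subspace s W"
  shows "class_mod W x = class_mod W y \<longleftrightarrow> x - y \<in> W"
proof -
  interpret vector_space s by fact
  have W: "0 \<in> W" "\<And>v w. v \<in> W \<Longrightarrow> w \<in> W \<Longrightarrow> v + w \<in> W"
    "\<And>v w. v \<in> W \<Longrightarrow> w \<in> W \<Longrightarrow> v - w \<in> W"
    using assms(2) by (auto intro: subspace_0 subspace_add subspace_diff)
  show ?thesis
  proof
    assume "class_mod W x = class_mod W y"
    moreover have "x \<in> class_mod W x"
      using W(1) by (force simp: class_mod_def)
    ultimately show "x - y \<in> W"
      by (auto simp: class_mod_def)
  next
    assume xy: "x - y \<in> W"
    have "x + w = y + ((x - y) + w)" "y + w = x + (w - (x - y))" for w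
      by (simp_all add: algebra_simps)
    then show "class_mod W x = class_mod W y"
      unfolding class_mod_def using W xy by blast
  qed
qed

text \<open>\<open>induced\<close> is a union of cosets over all representatives. The condition
  \<open>wd\<close> makes all these cosets equal, and \<open>0 \<in> W\<close> guarantees that
  \<open>x\<close> itself is one of the representatives, so the union is a single coset.\<close>

lemma induced_class:
  assumes "vector_space s" and W': "Modules.module.subspace s W'" and "0 \<in> W"
    and wd: "\<And>w. w \<in> W \<Longrightarrow> \<phi> (x + w) - \<phi> x \<in> W'"
  shows "induced W' \<phi> (class_mod W x) = class_mod W' (\<phi> x)"
proof -
  have "class_mod W' (\<phi> a) = class_mod W' (\<phi> x)" if "a \<in> class_mod W x" for a
    using that wd class_mod_eq_iff[OF assms(1) W'] by (auto simp: class_mod_def)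
  moreover have "x \<in> class_mod W x"
    using assms(3) by (force simp: class_mod_def)
  ultimately show ?thesis
    unfolding induced_def by blast
qed

lemma induced2_class:
  assumes "vector_space s" and W': "Modules.module.subspace s W'" and "0 \<in> U" "0 \<in> W"
    and wd: "\<And>v w. v \<in> U \<Longrightarrow> w \<in> W \<Longrightarrow> \<phi> (x + v) (y + w) - \<phi> x y \<in> W'"
  shows "induced2 W' \<phi> (class_mod U x) (class_mod W y) = class_mod W' (\<phi> x y)"
proof -
  have "class_mod W' (\<phi> a b) = class_mod W' (\<phi> x y)"
    if "a \<in> class_mod U x" "b \<in> class_mod W y" for a b
    using that wd class_mod_eq_iff[OF assms(1) W'] by (auto simp: class_mod_def)
  moreover have "x \<in> class_mod U x" "y \<in> class_mod W y"
    using assms(3,4) by (force simp: class_mod_def)+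
  ultimately show ?thesis
    unfolding induced2_def by blast
qed

lemma quot_space_simps:
  assumes "vector_space s" and W: "Modules.module.subspace s W"
  shows "class_mod W x \<oplus>\<^bsub>quot_space s Z W\<^esub> class_mod W y = class_mod W (x + y)"
    and "c \<odot>\<^bsub>quot_space s Z W\<^esub> class_mod W x = class_mod W (s c x)"
    and "\<zero>\<^bsub>quot_space s Z W\<^esub> = class_mod W 0"
    and "carrier (quot_space s Z W) = class_mod W ` Z"
proof -
  interpret vector_space s by fact
  have W0: "0 \<in> W"
    using W by (rule subspace_0)
  show "class_mod W x \<oplus>\<^bsub>quot_space s Z W\<^esub> class_mod W y = class_mod W (x + y)"
    \<comment> \<open>Addition of cosets is \<open>induced2 W\<close> of the addition of vectors,
      and scaling is \<open>induced W\<close> of \<open>s c\<close>, so the two preceding lemmas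
      evaluate both on representatives.\<close>
    using induced2_class[OF assms W0 W0, of "(+)" x y] W
    by (simp add: quot_space_def induced2_def algebra_simps subspace_add)
  show "c \<odot>\<^bsub>quot_space s Z W\<^esub> class_mod W x = class_mod W (s c x)"
    using induced_class[OF assms W0, of "s c" x] W
    by (simp add: quot_space_def induced_def algebra_simps scale_right_distrib subspace_scale)
qed (simp_all add: quot_space_def)

lemma quot_space_module:
  assumes "vector_space s" and W: "Modules.module.subspace s W" and Z: "Modules.module.subspace s Z"
  shows "Module.module field_ring (quot_space s Z W)"
proof -
  interpret vector_space s by fact
  note simps = quot_space_simps[OF assms(1,2)]
  have add: "v + w \<in> Z" if "v \<in> Z" "w \<in> Z" for v w
    using Z that by (rule subspace_add)
  have scale: "s c v \<in> Z" if "v \<in> Z" for c v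
    using Z that by (rule subspace_scale)
  have "\<exists>Y\<in>carrier (quot_space s Z W). Y \<oplus>\<^bsub>quot_space s Z W\<^esub> class_mod W x = \<zero>\<^bsub>quot_space s Z W\<^esub>"
    if "x \<in> Z" for x
    \<comment> \<open>The inverse class stays in the carrier because \<open>- x\<close> is
      \<open>x\<close> scaled by \<open>- 1\<close>, and \<open>Z\<close> is closed under
      scaling.\<close>
    using scale[OF that, of "- 1"] by (intro bexI[of _ "class_mod W (- x)"]) (auto simp: simps)
  then have "abelian_group (quot_space s Z W)"
    using subspace_0[OF Z] by (intro abelian_groupI) (auto simp: simps add ac_simps)
  then show ?thesis
    by (intro moduleI cring_field_ring)
      (auto simp: simps scale scale_left_distrib scale_right_distrib)
qed

section \<open>Graded algebras with a derivation of square zero\<close>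

text \<open>Linearity is required on carriers only: the type of cosets also contains sets that are
  not classes, on which an induced map means nothing.\<close>

definition module_map :: "('k::field, 'v) module \<Rightarrow> ('k, 'w) module \<Rightarrow> ('v \<Rightarrow> 'w) \<Rightarrow> bool" where
  "module_map V W \<phi> \<longleftrightarrow>
     (\<forall>x\<in>carrier V. \<phi> x \<in> carrier W) \<and>
     (\<forall>x\<in>carrier V. \<forall>y\<in>carrier V. \<phi> (x \<oplus>\<^bsub>V\<^esub> y) = \<phi> x \<oplus>\<^bsub>W\<^esub> \<phi> y) \<and>
     (\<forall>c. \<forall>x\<in>carrier V. \<phi> (c \<odot>\<^bsub>V\<^esub> x) = c \<odot>\<^bsub>W\<^esub> \<phi> x)"

lemma module_mapD:
  assumes "module_map V W \<phi>" and "x \<in> carrier V"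
  shows "\<phi> x \<in> carrier W"
    and "y \<in> carrier V \<Longrightarrow> \<phi> (x \<oplus>\<^bsub>V\<^esub> y) = \<phi> x \<oplus>\<^bsub>W\<^esub> \<phi> y"
    and "\<phi> (c \<odot>\<^bsub>V\<^esub> x) = c \<odot>\<^bsub>W\<^esub> \<phi> x"
  using assms by (auto simp: module_map_def)

text \<open>The condition on \<open>W\<close> makes the induced map well defined; the one on
  \<open>Z\<close> puts its values into the target carrier.\<close>

lemma module_map_quot_space:
  assumes s: "vector_space s" "Modules.module.subspace s W"
    and t: "vector_space t" "Modules.module.subspace t W'"
    and lin: "Vector_Spaces.linear s t \<phi>"
    and maps: "\<And>z. z \<in> Z \<Longrightarrow> \<phi> z \<in> Z'" "\<And>w. w \<in> W \<Longrightarrow> \<phi> w \<in> W'"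
  shows "induced W' \<phi> (class_mod W x) = class_mod W' (\<phi> x)"
    and "module_map (quot_space s Z W) (quot_space t Z' W') (induced W' \<phi>)"
proof -
  interpret Vector_Spaces.linear s t \<phi> by fact
  have W0: "0 \<in> W"
    using s(2) by (rule vs1.subspace_0)
  show *: "induced W' \<phi> (class_mod W x) = class_mod W' (\<phi> x)" for x
    by (rule induced_class[OF t W0]) (simp add: add maps)
  show "module_map (quot_space s Z W) (quot_space t Z' W') (induced W' \<phi>)"
    by (auto simp: module_map_def quot_space_simps[OF s] quot_space_simps[OF t] * maps add scale)
qed

section \<open>Graded commutative algebras and their transport along linear bijections\<close>

lemma graded_bilinearD:
  assumes "graded_bilinear V d m" and "x \<in> carrier (V p)" and "y \<in> carrier (V q)"
  shows "m p q x y \<in> carrier (V (p + q + d))"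
    and "x' \<in> carrier (V p) \<Longrightarrow> m p q (x \<oplus>\<^bsub>V p\<^esub> x') y = m p q x y \<oplus>\<^bsub>V (p + q + d)\<^esub> m p q x' y"
    and "y' \<in> carrier (V q) \<Longrightarrow> m p q x (y \<oplus>\<^bsub>V q\<^esub> y') = m p q x y \<oplus>\<^bsub>V (p + q + d)\<^esub> m p q x y'"
    and "m p q (c \<odot>\<^bsub>V p\<^esub> x) y = c \<odot>\<^bsub>V (p + q + d)\<^esub> m p q x y"
    and "m p q x (c \<odot>\<^bsub>V q\<^esub> y) = c \<odot>\<^bsub>V (p + q + d)\<^esub> m p q x y"
  using assms by (auto simp: graded_bilinear_def)

lemma graded_comm_algebraD:
  assumes "graded_comm_algebra V m"
  shows "Module.module field_ring (V n)"
    and "graded_bilinear V 0 m"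
    and "x \<in> carrier (V p) \<Longrightarrow> y \<in> carrier (V q) \<Longrightarrow>
      m p q x y = (- 1) powi (p * q) \<odot>\<^bsub>V (p + q)\<^esub> m q p y x"
    and "x \<in> carrier (V p) \<Longrightarrow> y \<in> carrier (V q) \<Longrightarrow> z \<in> carrier (V r) \<Longrightarrow>
      m (p + q) r (m p q x y) z = m p (q + r) x (m q r y z)"
  using assms unfolding graded_comm_algebra_def by blast+

text \<open>The inverse of a linear bijection is linear, so every axiom on \<open>W\<close> is the
  image under \<open>\<phi>\<close> of the same axiom on \<open>V\<close>.\<close>

lemma graded_comm_algebra_transport:
  assumes V: "graded_comm_algebra V m" and W: "\<And>n. Module.module field_ring (W n)"
    and \<phi>: "\<And>n. module_map (V n) (W n) (\<phi> n)" "\<And>n. bij_betw (\<phi> n) (carrier (V n)) (carrier (W n))"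
  shows "graded_comm_algebra W (\<lambda>p q x y. \<phi> (p + q)
    (m p q (inv_into (carrier (V p)) (\<phi> p) x) (inv_into (carrier (V q)) (\<phi> q) y)))"
proof -
  let ?\<psi> = "\<lambda>n. inv_into (carrier (V n)) (\<phi> n)"
  note m = graded_comm_algebraD(2)[OF V]
  have inv [simp]: "?\<psi> n (\<phi> n x) = x" if "x \<in> carrier (V n)" for n x
    using \<phi>(2)[of n] that by (simp add: bij_betw_inv_into_left)
  have ex: "?\<psi> n x \<in> carrier (V n)" "\<phi> n (?\<psi> n x) = x" if "x \<in> carrier (W n)" for n x
    using \<phi>(2)[of n] that
    by (auto simp: bij_betw_inv_into_right intro: bij_betwE[OF bij_betw_inv_into, rule_format])
  have [simp]: "\<phi> n v \<in> carrier (W n)" if "v \<in> carrier (V n)" for n v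
    using module_mapD(1)[OF \<phi>(1) that] .
  have mod: "Module.module field_ring (V n)" for n
    by (rule graded_comm_algebraD(1)[OF V])
  \<comment> \<open>Oriented so that rewriting collects an expression in \<open>W\<close> under one
    outer \<open>\<phi>\<close>, which the inverse then cancels.\<close>
  have add: "\<phi> n v \<oplus>\<^bsub>W n\<^esub> \<phi> n w = \<phi> n (v \<oplus>\<^bsub>V n\<^esub> w)" "v \<oplus>\<^bsub>V n\<^esub> w \<in> carrier (V n)"
    if "v \<in> carrier (V n)" "w \<in> carrier (V n)" for n v w
    using module_mapD(2)[OF \<phi>(1)] that abelian_group.axioms[OF module.axioms(2)[OF mod[of n]]]
    by (auto intro: abelian_monoid.a_closed)
  have smult: "c \<odot>\<^bsub>W n\<^esub> \<phi> n v = \<phi> n (c \<odot>\<^bsub>V n\<^esub> v)" "c \<odot>\<^bsub>V n\<^esub> v \<in> carrier (V n)"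
    if "v \<in> carrier (V n)" for n v c
    using module_mapD(3)[OF \<phi>(1)] that module.smult_closed[OF mod[of n]] by auto
  have mult: "m p q v w \<in> carrier (V (p + q))"
    if "v \<in> carrier (V p)" "w \<in> carrier (V q)" for p q v w
    using graded_bilinearD(1)[OF m that] by simp
  note bil = graded_bilinearD(2-5)[OF m, simplified]
  have inv_add: "?\<psi> n (x \<oplus>\<^bsub>W n\<^esub> y) = ?\<psi> n x \<oplus>\<^bsub>V n\<^esub> ?\<psi> n y" if "x \<in> carrier (W n)" "y \<in> carrier (W n)" for n x y
    using add[OF ex(1) ex(1), OF that] that by (simp add: ex)
  have inv_smult: "?\<psi> n (c \<odot>\<^bsub>W n\<^esub> x) = c \<odot>\<^bsub>V n\<^esub> ?\<psi> n x" if "x \<in> carrier (W n)" for n c x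
    using smult[OF ex(1), OF that] that by (simp add: ex)
  note comm = graded_comm_algebraD(3)[OF V]
  note assoc = graded_comm_algebraD(4)[OF V]
  show ?thesis
    unfolding graded_comm_algebra_def graded_bilinear_def
  proof (intro conjI allI ballI)
    show "Module.module field_ring (W n)" for n
      by (rule W)
  next
    fix p q x y assume xy: "x \<in> carrier (W p)" "y \<in> carrier (W q)"
    show "\<phi> (p + q) (m p q (?\<psi> p x) (?\<psi> q y)) =
        (- 1) powi (p * q) \<odot>\<^bsub>W (p + q)\<^esub> \<phi> (q + p) (m q p (?\<psi> q y) (?\<psi> p x))"
      using comm[OF ex(1) ex(1), OF xy] mult[OF ex(1) ex(1), OF xy(2,1)]
      by (simp add: smult add.commute[of q p])
  next
    fix p q r x y z
    assume "x \<in> carrier (W p)" "y \<in> carrier (W q)" "z \<in> carrier (W r)"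
    then show "\<phi> (p + q + r) (m (p + q) r (?\<psi> (p + q) (\<phi> (p + q) (m p q (?\<psi> p x) (?\<psi> q y)))) (?\<psi> r z)) =
        \<phi> (p + (q + r)) (m p (q + r) (?\<psi> p x) (?\<psi> (q + r) (\<phi> (q + r) (m q r (?\<psi> q y) (?\<psi> r z)))))"
      by (simp add: mult assoc add.assoc ex)
  qed (simp_all add: ex inv_add inv_smult mult bil add smult)
qed

section \<open>The degree -2 bracket of a square-zero derivation\<close>

text \<open>Nested signs and negatives are collected into one scalar, which reduces sign questions
  in the module to identities in the field.\<close>

lemma module_sign:
  assumes "Module.module field_ring V" and "x \<in> carrier V"
  shows "a \<odot>\<^bsub>V\<^esub> (b \<odot>\<^bsub>V\<^esub> x) = (a * b) \<odot>\<^bsub>V\<^esub> x" and "\<ominus>\<^bsub>V\<^esub> x = (- 1) \<odot>\<^bsub>V\<^esub> x"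
proof -
  interpret Module.module field_ring V by fact
  show "a \<odot>\<^bsub>V\<^esub> (b \<odot>\<^bsub>V\<^esub> x) = (a * b) \<odot>\<^bsub>V\<^esub> x"
    using smult_assoc1[of a b x] assms(2) by simp
  have "x \<oplus>\<^bsub>V\<^esub> (- 1) \<odot>\<^bsub>V\<^esub> x = \<zero>\<^bsub>V\<^esub>"
    using smult_l_distr[of 1 "- 1" x] smult_l_null[of x] smult_one[of x] assms(2) by simp
  then show "\<ominus>\<^bsub>V\<^esub> x = (- 1) \<odot>\<^bsub>V\<^esub> x"
    using assms(2) by (intro minus_equality) (auto simp: a_comm)
qed

text \<open>With \<open>D D = 0\<close>, the derivation rule kills
  \<open>D (D x \<smile> D y)\<close>, so brackets are \<open>D\<close>-closed. A bracket with a
  \<open>D\<close>-closed argument is zero, hence all double brackets vanish. Antisymmetry is graded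
  commutativity in the degrees \<open>p - 1\<close> and \<open>q - 1\<close>, and the Leibniz rule
  comes from expanding \<open>D (y \<smile> z)\<close>.\<close>

lemma e3_algebra_of_derivation:
  fixes V :: "('k::field, 'v) graded_vs"
  assumes V: "graded_comm_algebra V m"
    and D: "\<And>p. module_map (V p) (V (p - 1)) (D p)"
    and DD: "\<And>p x. x \<in> carrier (V p) \<Longrightarrow> D (p - 1) (D p x) = \<zero>\<^bsub>V (p - 2)\<^esub>"
    and der: "\<And>p q x y. x \<in> carrier (V p) \<Longrightarrow> y \<in> carrier (V q) \<Longrightarrow>
      D (p + q) (m p q x y) = m (p - 1) q (D p x) y \<oplus>\<^bsub>V (p + q - 1)\<^esub>
        (- 1) powi p \<odot>\<^bsub>V (p + q - 1)\<^esub> m p (q - 1) x (D q y)"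
    and br: "\<And>p q x y. br p q x y = (- 1) powi p \<odot>\<^bsub>V (p + q - 2)\<^esub> m (p - 1) (q - 1) (D p x) (D q y)"
  shows "x \<in> carrier (V p) \<Longrightarrow> y \<in> carrier (V q) \<Longrightarrow>
      D (p + q - 2) (br p q x y) = \<zero>\<^bsub>V (p + q - 3)\<^esub>"
    and "lie_bracket_deg_minus_2 V br"
    and "e3_algebra V m br"
proof -
  note mod = graded_comm_algebraD(1)[OF V]
  note bil = graded_comm_algebraD(2)[OF V]
  note m_lin = graded_bilinearD(2-5)[OF bil, simplified]
  have grp: "abelian_group (V n)" for n
    using mod[of n] by (rule module.axioms)
  note zero = abelian_monoid.zero_closed[OF abelian_group.axioms(1)[OF grp]]
  note zero_add = abelian_monoid.l_zero[OF abelian_group.axioms(1)[OF grp]]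
  have smult: "c \<odot>\<^bsub>V n\<^esub> x \<in> carrier (V n)" if "x \<in> carrier (V n)" for c n x
    using module.smult_closed[OF mod] that by simp
  have smult_zero: "c \<odot>\<^bsub>V n\<^esub> \<zero>\<^bsub>V n\<^esub> = \<zero>\<^bsub>V n\<^esub>" for c n
    using module.smult_r_null[OF mod] by simp
  have zero_smult: "0 \<odot>\<^bsub>V n\<^esub> x = \<zero>\<^bsub>V n\<^esub>" if "x \<in> carrier (V n)" for n x
    using module.smult_l_null[OF mod] that by simp
  have smult_add: "c \<odot>\<^bsub>V n\<^esub> (x \<oplus>\<^bsub>V n\<^esub> y) = c \<odot>\<^bsub>V n\<^esub> x \<oplus>\<^bsub>V n\<^esub> c \<odot>\<^bsub>V n\<^esub> y"
    if "x \<in> carrier (V n)" "y \<in> carrier (V n)" for c n x y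
    using module.smult_r_distr[OF mod] that by simp
  note sign = module_sign[OF mod]
  \<comment> \<open>From here on target degrees are variables fixed by equations, because degrees
    such as \<open>(p - 1) + (q - 1)\<close> and \<open>p + q - 2\<close> are equal but do not match
    syntactically.\<close>
  have m: "m i j x y \<in> carrier (V k)"
    if "x \<in> carrier (V i)" "y \<in> carrier (V j)" "k = i + j" for i j k x y
    using graded_bilinearD(1)[OF bil] that by simp
  have m_zero: "m i j \<zero>\<^bsub>V i\<^esub> y = \<zero>\<^bsub>V k\<^esub>" if "y \<in> carrier (V j)" "k = i + j" for i j k y
    \<comment> \<open>The zero vector is written as \<open>0\<close> times itself, and the scalar is
      pulled out of the product.\<close>
    using m_lin(3)[OF zero[of i] that(1), of 0] that zero zero_smult m by simp
  have zero_m: "m i j x \<zero>\<^bsub>V j\<^esub> = \<zero>\<^bsub>V k\<^esub>" if "x \<in> carrier (V i)" "k = i + j" for i j k x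
    using m_lin(4)[OF that(1) zero[of j], of 0] that zero zero_smult m by simp
  have assoc: "m k l (m i j x y) z = m i n x (m j l y z)"
    if "x \<in> carrier (V i)" "y \<in> carrier (V j)" "z \<in> carrier (V l)" "k = i + j" "n = j + l"
    for i j k l n x y z
    using graded_comm_algebraD(4)[OF V] that by simp
  have comm: "m i j x y = (- 1) powi (i * j) \<odot>\<^bsub>V k\<^esub> m j i y x"
    if "x \<in> carrier (V i)" "y \<in> carrier (V j)" "k = i + j" for i j k x y
    using graded_comm_algebraD(3)[OF V that(1,2)] that(3) by simp
  have D1: "D p x \<in> carrier (V q)" if "x \<in> carrier (V p)" "q = p - 1" for p q x
    using module_mapD(1)[OF D] that by simp
  have der': "D k (m i j x y) = m i' j (D i x) y \<oplus>\<^bsub>V l\<^esub> (- 1) powi i \<odot>\<^bsub>V l\<^esub> m i j' x (D j y)"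
    if "x \<in> carrier (V i)" "y \<in> carrier (V j)" "k = i + j" "l = i + j - 1" "i' = i - 1" "j' = j - 1"
    for i j k l i' j' x y
    using der that by simp
  have m_smult: "m i j (c \<odot>\<^bsub>V i\<^esub> x) y = c \<odot>\<^bsub>V k\<^esub> m i j x y"
      "m i j x (c \<odot>\<^bsub>V j\<^esub> y) = c \<odot>\<^bsub>V k\<^esub> m i j x y"
    if "x \<in> carrier (V i)" "y \<in> carrier (V j)" "k = i + j" for i j k c x y
    using m_lin that by auto
  have br1: "br p q x y \<in> carrier (V r)"
    if "x \<in> carrier (V p)" "y \<in> carrier (V q)" "r = p + q - 2" for p q r x y
    using that by (auto simp: br intro!: smult m D1)
  have Dbr: "D k (br p q x y) = \<zero>\<^bsub>V l\<^esub>"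
    if "x \<in> carrier (V p)" "y \<in> carrier (V q)" "k = p + q - 2" "l = p + q - 3" for p q k l x y
  proof -
    have xy: "D p x \<in> carrier (V (p - 1))" "D q y \<in> carrier (V (q - 1))"
      using that by (auto intro: D1)
    \<comment> \<open>Each of the two terms of the derivation rule contains a factor
      \<open>D D\<close>.\<close>
    have "D k (m (p - 1) (q - 1) (D p x) (D q y)) =
        m (p - 2) (q - 1) (D (p - 1) (D p x)) (D q y) \<oplus>\<^bsub>V l\<^esub>
        (- 1) powi (p - 1) \<odot>\<^bsub>V l\<^esub> m (p - 1) (q - 2) (D p x) (D (q - 1) (D q y))"
      by (rule der') (use that xy in auto)
    also have "\<dots> = \<zero>\<^bsub>V l\<^esub>"
      using that xy by (simp add: DD m_zero[of _ _ l] zero_m[of _ _ l] smult_zero zero_add zero)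
    finally have "D k (m (p - 1) (q - 1) (D p x) (D q y)) = \<zero>\<^bsub>V l\<^esub>" .
    moreover have "D k (br p q x y) = (- 1) powi p \<odot>\<^bsub>V l\<^esub> D k (m (p - 1) (q - 1) (D p x) (D q y))"
      using module_mapD(3)[OF D[of k], OF m[OF xy, of k], of "(- 1) powi p"] that by (simp add: br)
    ultimately show ?thesis
      by (simp add: smult_zero)
  qed
  then show "x \<in> carrier (V p) \<Longrightarrow> y \<in> carrier (V q) \<Longrightarrow>
      D (p + q - 2) (br p q x y) = \<zero>\<^bsub>V (p + q - 3)\<^esub>"
    by simp
  \<comment> \<open>Together with \<open>Dbr\<close> this annihilates each of the three terms of the
    Jacobi identity separately.\<close>
  have br_zero: "br p q x y = \<zero>\<^bsub>V k\<^esub>"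
    if "D p x = \<zero>\<^bsub>V (p - 1)\<^esub> \<and> y \<in> carrier (V q) \<or> x \<in> carrier (V p) \<and> D q y = \<zero>\<^bsub>V (q - 1)\<^esub>" "k = p + q - 2"
    for p q k x y
    using that by (auto simp: br m_zero[of _ _ k] zero_m[of _ _ k] D1 smult_zero)
  show lie: "lie_bracket_deg_minus_2 V br"
    unfolding lie_bracket_deg_minus_2_def
  proof (intro conjI allI ballI)
    show "graded_bilinear V (- 2) br"
      unfolding graded_bilinear_def
    proof (intro conjI allI ballI)
      fix p q x x' y assume xy: "x \<in> carrier (V p)" "x' \<in> carrier (V p)" "y \<in> carrier (V q)"
      have "D p x \<in> carrier (V (p - 1))" "D p x' \<in> carrier (V (p - 1))" "D q y \<in> carrier (V (q - 1))"
        using xy by (auto intro: D1)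
      then show "br p q (x \<oplus>\<^bsub>V p\<^esub> x') y = br p q x y \<oplus>\<^bsub>V (p + q + - 2)\<^esub> br p q x' y"
        using xy m_lin(1)[of "D p x" "p - 1" "D q y" "q - 1" "D p x'"]
        by (simp add: br module_mapD(2)[OF D] smult_add m)
    next
      fix p q x y y' assume xy: "x \<in> carrier (V p)" "y \<in> carrier (V q)" "y' \<in> carrier (V q)"
      have "D p x \<in> carrier (V (p - 1))" "D q y' \<in> carrier (V (q - 1))" "D q y \<in> carrier (V (q - 1))"
        using xy by (auto intro: D1)
      then show "br p q x (y \<oplus>\<^bsub>V q\<^esub> y') = br p q x y \<oplus>\<^bsub>V (p + q + - 2)\<^esub> br p q x y'"
        using xy m_lin(2)[of "D p x" "p - 1" "D q y" "q - 1" "D q y'"]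
        by (simp add: br module_mapD(2)[OF D] smult_add m)
    next
      fix p q c x y assume xy: "x \<in> carrier (V p)" "y \<in> carrier (V q)"
      have D: "D p x \<in> carrier (V (p - 1))" "D q y \<in> carrier (V (q - 1))"
        using xy by (auto intro: D1)
      show "br p q (c \<odot>\<^bsub>V p\<^esub> x) y = c \<odot>\<^bsub>V (p + q + - 2)\<^esub> br p q x y"
        "br p q x (c \<odot>\<^bsub>V q\<^esub> y) = c \<odot>\<^bsub>V (p + q + - 2)\<^esub> br p q x y"
        using xy D
        by (simp_all add: br module_mapD(3)[OF assms(2)] m_smult[of _ _ _ _ "p + q - 2"] sign m mult.commute)
    qed (simp add: br1)
  next
    fix p q x y assume xy: "x \<in> carrier (V p)" "y \<in> carrier (V q)"
    have D: "D p x \<in> carrier (V (p - 1))" "D q y \<in> carrier (V (q - 1))"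
      using xy by (auto intro: D1)
    have "m (q - 1) (p - 1) (D q y) (D p x) \<in> carrier (V (p + q - 2))"
      using D by (auto intro: m)
    \<comment> \<open>Swapping \<open>D x\<close> and \<open>D y\<close> costs
      \<open>(-1)^((p-1)(q-1))\<close>; the signs agree since \<open>p + (p-1)(q-1)\<close> and
      \<open>1 + pq + q\<close> have the same parity.\<close>
    then show "br p q x y = \<ominus>\<^bsub>V (p + q - 2)\<^esub> ((- 1) powi (p * q) \<odot>\<^bsub>V (p + q - 2)\<^esub> br q p y x)"
      unfolding br comm[OF D, of "p + q - 2", simplified] add.commute[of q p]
      by (simp add: sign smult) (auto simp: minus_one_powi)
  next
    fix p q r x y z assume "x \<in> carrier (V p)" "y \<in> carrier (V q)" "z \<in> carrier (V r)"
    then show "br p (q + r - 2) x (br q r y z) =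
          br (p + q - 2) r (br p q x y) z \<oplus>\<^bsub>V (p + q + r - 4)\<^esub>
          (- 1) powi (p * q) \<odot>\<^bsub>V (p + q + r - 4)\<^esub> br q (p + r - 2) y (br p r x z)"
      by (simp add: Dbr br_zero[of _ _ _ _ "p + q + r - 4"] smult_zero zero_add zero)
  qed
  show "e3_algebra V m br"
    unfolding e3_algebra_def
  proof (intro conjI allI ballI V lie)
    fix p q r x y z
    assume xyz: "x \<in> carrier (V p)" "y \<in> carrier (V q)" "z \<in> carrier (V r)"
    let ?W = "V (p + q + r - 2)"
    have Dx: "D p x \<in> carrier (V (p - 1))" and Dy: "D q y \<in> carrier (V (q - 1))"
      and Dz: "D r z \<in> carrier (V (r - 1))"
      using xyz by (auto intro: D1)
    \<comment> \<open>Up to signs, \<open>u\<close> and \<open>v\<close> are the two summands of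
      \<open>D x \<smile> D (y \<smile> z)\<close>; all three terms of the Leibniz rule are
      rewritten in them.\<close>
    define u where "u = m (p - 1) (q + r - 1) (D p x) (m (q - 1) r (D q y) z)"
    define v where "v = m (p - 1) (q + r - 1) (D p x) (m q (r - 1) y (D r z))"
    have u: "u \<in> carrier ?W" and v: "v \<in> carrier ?W"
      unfolding u_def v_def using xyz Dx Dy Dz by (auto intro!: m)
    have "D (q + r) (m q r y z) = m (q - 1) r (D q y) z \<oplus>\<^bsub>V (q + r - 1)\<^esub>
        (- 1) powi q \<odot>\<^bsub>V (q + r - 1)\<^esub> m q (r - 1) y (D r z)"
      by (rule der[OF xyz(2,3)])
    moreover have "m (q - 1) r (D q y) z \<in> carrier (V (q + r - 1))"
      "m q (r - 1) y (D r z) \<in> carrier (V (q + r - 1))"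
      using xyz Dy Dz by (auto intro!: m)
    moreover have "p - 1 + (q + r - 1) = p + q + r - 2"
      by simp
    ultimately have "m (p - 1) (q + r - 1) (D p x) (D (q + r) (m q r y z)) =
        u \<oplus>\<^bsub>?W\<^esub> (- 1) powi q \<odot>\<^bsub>?W\<^esub> v"
      using Dx by (simp add: m_lin(2,4) smult u_def v_def add.assoc)
    then have "br p (q + r) x (m q r y z) = (- 1) powi p \<odot>\<^bsub>?W\<^esub> u \<oplus>\<^bsub>?W\<^esub> ((- 1) powi p * (- 1) powi q) \<odot>\<^bsub>?W\<^esub> v"
      using u v by (simp add: br smult smult_add sign add.assoc)
    moreover have "m (p + q - 2) r (br p q x y) z = (- 1) powi p \<odot>\<^bsub>?W\<^esub> u"
    proof -
      have "m (p + q - 2) r (m (p - 1) (q - 1) (D p x) (D q y)) z = u"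
        unfolding u_def by (rule assoc[OF Dx Dy xyz(3)]) auto
      then show ?thesis
        using xyz Dx Dy by (simp add: br m_smult[of _ _ _ _ "p + q + r - 2"] m)
    qed
    moreover have "m q (p + r - 2) y (br p r x z) = ((- 1) powi p * (- 1) powi (q * (p - 1))) \<odot>\<^bsub>?W\<^esub> v"
    proof -
      \<comment> \<open>Reassociate, move \<open>y\<close> of degree \<open>q\<close> past
        \<open>D x\<close> of degree \<open>p - 1\<close>, and reassociate back.\<close>
      have "m q (p + r - 2) y (m (p - 1) (r - 1) (D p x) (D r z)) =
          m (q + p - 1) (r - 1) (m q (p - 1) y (D p x)) (D r z)"
        by (rule assoc[symmetric, OF xyz(2) Dx Dz]) auto
      also have "\<dots> = (- 1) powi (q * (p - 1)) \<odot>\<^bsub>?W\<^esub> m (q + p - 1) (r - 1) (m (p - 1) q (D p x) y) (D r z)"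
        using xyz Dx Dz comm[OF xyz(2) Dx, of "q + p - 1"]
        by (simp add: m_smult[of _ _ _ _ "p + q + r - 2"] m)
      also have "m (q + p - 1) (r - 1) (m (p - 1) q (D p x) y) (D r z) = v"
        unfolding v_def by (rule assoc[OF Dx xyz(2) Dz]) auto
      finally show ?thesis
        using xyz Dx Dz v by (simp add: br m_smult[of _ _ _ _ "p + q + r - 2"] m sign)
    qed
    ultimately show "br p (q + r) x (m q r y z) = m (p + q - 2) r (br p q x y) z \<oplus>\<^bsub>?W\<^esub>
        (- 1) powi (p * q) \<odot>\<^bsub>?W\<^esub> m q (p + r - 2) y (br p r x z)"
      \<comment> \<open>What remains is the coefficient of \<open>v\<close>: \<open>p + q\<close>
        and \<open>pq + p + q(p-1)\<close> have the same parity.\<close>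
      using v by (simp add: sign) (auto simp: minus_one_powi)
  qed
qed

section \<open>Operations on cohomology\<close>

lemma cochain_complexD:
  assumes "cochain_complex K"
  shows "vector_space (scl K)"
    and "Modules.module.subspace (scl K) (spc K n)"
    and "Vector_Spaces.linear (scl K) (scl K) (dif K)"
    and "x \<in> spc K n \<Longrightarrow> dif K x \<in> spc K (n + 1)"
    and "dif K (dif K x) = 0"
  using assms by (auto simp: cochain_complex_def graded_space_def)

lemma subspace_cocycles:
  assumes "cochain_complex K"
  shows "Modules.module.subspace (scl K) (cocycles K n)"
proof -
  interpret Vector_Spaces.linear "scl K" "scl K" "dif K"
    using assms by (rule cochain_complexD)
  show ?thesis
    using cochain_complexD(2)[OF assms, of n]
    by (auto simp: cocycles_def vs1.subspace_def add scale zero)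
qed

lemma subspace_coboundaries:
  assumes "cochain_complex K"
  shows "Modules.module.subspace (scl K) (coboundaries K n)"
proof -
  interpret Vector_Spaces.linear "scl K" "scl K" "dif K"
    using assms by (rule cochain_complexD)
  show ?thesis
    unfolding coboundaries_def using cochain_complexD(2)[OF assms] by (rule subspace_image)
qed

lemma coboundary_cocycle:
  assumes "cochain_complex K" and "w \<in> coboundaries K n"
  shows "w \<in> cocycles K n"
  using assms cochain_complexD(4)[OF assms(1), of _ "n - 1"]
  by (auto simp: coboundaries_def cocycles_def cochain_complexD(5))

lemma cohomology_module:
  assumes "cochain_complex K"
  shows "Module.module field_ring (cohomology K n)"
  unfolding cohomology_def
  by (intro quot_space_module cochain_complexD(1) subspace_cocycles subspace_coboundaries assms)

text \<open>A derivation property makes a bilinear operation descend: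
  \<open>m (d a) y = d (m a y)\<close> for a cocycle \<open>y\<close>, and \<open>m f (d a)\<close>
  is a sign times \<open>d (m f a)\<close>. Here \<open>d\<close> is the degree of the operation and
  \<open>e\<close> the shift of the degree in the Koszul sign: both are 0 for the Lie bracket and 1
  for the product.\<close>

lemma induced2_cohomology:
  fixes K :: "('k::field, 'a::ab_group_add, 'z) cochain_complex_scheme"
  assumes K: "cochain_complex K" and "bilin (scl K) (scl K) (scl K) m"
    and deg: "\<And>p q f g. f \<in> spc K p \<Longrightarrow> g \<in> spc K q \<Longrightarrow> m f g \<in> spc K (p + q + d)"
    and der: "\<And>p q f g. f \<in> spc K p \<Longrightarrow> g \<in> spc K q \<Longrightarrow>
      dif K (m f g) = m (dif K f) g + scl K ((- 1) powi (p + e)) (m f (dif K g))"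
    and f: "f \<in> cocycles K p" and g: "g \<in> cocycles K q" and n: "n = p + q + d"
  shows "m f g \<in> cocycles K n"
    and "induced2 (coboundaries K n) m (class_mod (coboundaries K p) f) (class_mod (coboundaries K q) g) =
      class_mod (coboundaries K n) (m f g)"
proof -
  interpret d: Vector_Spaces.linear "scl K" "scl K" "dif K"
    using K by (rule cochain_complexD)
  have l: "Vector_Spaces.linear (scl K) (scl K) (m x)" "Vector_Spaces.linear (scl K) (scl K) (\<lambda>x. m x y)" for x y
    using assms(2) by (auto simp: bilin_def)
  have m_add: "m (x + x') y = m x y + m x' y" "m x (y + y') = m x y + m x y'" for x x' y y'
    using l[unfolded Vector_Spaces.linear_iff] by auto
  have m_zero: "m 0 y = 0" "m x 0 = 0" for x y
    using m_add(1)[of 0 0 y] m_add(2)[of x 0 0] by simp_all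
  show "m f g \<in> cocycles K n"
    using f g deg[of f p g q] der[of f p g q] n by (simp add: cocycles_def m_zero)
  note sub = subspace_coboundaries[OF K, of n]
  \<comment> \<open>Needed for every cocycle \<open>y\<close>, because it is applied to the modified
    representative \<open>g + w\<close>.\<close>
  have left: "m v y \<in> coboundaries K n" if v: "v \<in> coboundaries K p" and y: "y \<in> cocycles K q" for v y
  proof -
    obtain a where a: "v = dif K a" "a \<in> spc K (p - 1)"
      using v by (auto simp: coboundaries_def)
    then have "m v y = dif K (m a y)" "m a y \<in> spc K (n - 1)"
      using y der[of a "p - 1" y q] deg[of a "p - 1" y q] n
      by (auto simp: cocycles_def m_zero algebra_simps)
    then show ?thesis
      by (auto simp: coboundaries_def)
  qed
  have right: "m f w \<in> coboundaries K n" if "w \<in> coboundaries K q" for w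
  proof -
    obtain a where a: "w = dif K a" "a \<in> spc K (q - 1)"
      using \<open>w \<in> coboundaries K q\<close> by (auto simp: coboundaries_def)
    then have "dif K (m f a) = scl K ((- 1) powi (p + e)) (m f w)" and ma: "m f a \<in> spc K (n - 1)"
      using f der[of f p a "q - 1"] deg[of f p a "q - 1"] n
      by (auto simp: cocycles_def m_zero algebra_simps)
    \<comment> \<open>A sign is its own inverse.\<close>
    then have "m f w = scl K ((- 1) powi (p + e)) (dif K (m f a))"
      by (auto simp: minus_one_powi)
    then show ?thesis
      using d.vs1.subspace_scale[OF sub] ma by (auto simp: coboundaries_def)
  qed
  show "induced2 (coboundaries K n) m (class_mod (coboundaries K p) f) (class_mod (coboundaries K q) g) =
      class_mod (coboundaries K n) (m f g)"
  proof (rule induced2_class[OF cochain_complexD(1)[OF K] sub])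
    fix v w assume v: "v \<in> coboundaries K p" and w: "w \<in> coboundaries K q"
    have "g + w \<in> cocycles K q"
      using g coboundary_cocycle[OF K w] d.vs1.subspace_add[OF subspace_cocycles[OF K]] by blast
    moreover have "m (f + v) (g + w) - m f g = m v (g + w) + m f w"
      by (simp add: m_add)
    ultimately show "m (f + v) (g + w) - m f g \<in> coboundaries K n"
      using left[OF v] right[OF w] d.vs1.subspace_add[OF sub] by simp
  qed (use d.vs1.subspace_0 subspace_coboundaries[OF K] in blast)+
qed

text \<open>In the first four facts \<open>n\<close> is the shifted degree, so that classes live in
  degree \<open>n - 1\<close> of \<open>K\<close>; in the last one \<open>n\<close> is the degree in
  \<open>K\<close>.\<close>

lemma shifted_simps:
  assumes "cochain_complex K"
  shows "carrier (shifted K n) = class_mod (coboundaries K (n - 1)) ` cocycles K (n - 1)"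
    and "class_mod (coboundaries K (n - 1)) x \<oplus>\<^bsub>shifted K n\<^esub> class_mod (coboundaries K (n - 1)) y =
      class_mod (coboundaries K (n - 1)) (x + y)"
    and "c \<odot>\<^bsub>shifted K n\<^esub> class_mod (coboundaries K (n - 1)) x = class_mod (coboundaries K (n - 1)) (scl K c x)"
    and "\<zero>\<^bsub>shifted K n\<^esub> = class_mod (coboundaries K (n - 1)) 0"
    and "class_mod (coboundaries K n) x = class_mod (coboundaries K n) y \<longleftrightarrow> x - y \<in> coboundaries K n"
  unfolding shifted_def cohomology_def
  using cochain_complexD(1)[OF assms] subspace_coboundaries[OF assms]
  by (simp_all add: quot_space_simps class_mod_eq_iff)

section \<open>The operator induced by B on cohomology\<close>

lemma mixed_complexD:
  assumes "mixed_complex M"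
  shows "cochain_complex M"
    and "Vector_Spaces.linear (scl M) (scl M) (Bop M)"
    and "x \<in> spc M n \<Longrightarrow> Bop M x \<in> spc M (n - 1)"
    and "Bop M (Bop M x) = 0"
    and "Bop M (dif M x) = - dif M (Bop M x)"
  using assms by (auto simp: mixed_complex_def eq_neg_iff_add_eq_0 add.commute)

text \<open>As \<open>b\<close> and \<open>B\<close> anticommute, \<open>B\<close> preserves
  cocycles and sends \<open>b a\<close> to \<open>b (- B a)\<close>.\<close>

lemma BV_class:
  assumes M: "mixed_complex M"
  shows "x \<in> cocycles M n \<Longrightarrow> Bop M x \<in> cocycles M (n - 1)"
    and "BV M p (class_mod (coboundaries M (p - 1)) x) = class_mod (coboundaries M (p - 2)) (Bop M x)"
    and "module_map (shifted M p) (shifted M (p - 1)) (BV M p)"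
proof -
  note K = mixed_complexD(1)[OF M]
  interpret d: Vector_Spaces.linear "scl M" "scl M" "dif M"
    using K by (rule cochain_complexD)
  interpret B: Vector_Spaces.linear "scl M" "scl M" "Bop M"
    using M by (rule mixed_complexD)
  show *: "x \<in> cocycles M n \<Longrightarrow> Bop M x \<in> cocycles M (n - 1)" for x n
    using mixed_complexD(3)[OF M] mixed_complexD(5)[OF M, of x] by (simp add: cocycles_def B.zero)
  have cob: "Bop M w \<in> coboundaries M (n - 1)" if "w \<in> coboundaries M n" for w n
  proof -
    obtain a where "w = dif M a" "a \<in> spc M (n - 1)"
      using \<open>w \<in> coboundaries M n\<close> by (auto simp: coboundaries_def)
    then have "Bop M w = dif M (- Bop M a)" "- Bop M a \<in> spc M (n - 1 - 1)"
      using d.vs1.subspace_neg[OF cochain_complexD(2)[OF K] mixed_complexD(3)[OF M]]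
      by (simp_all only: mixed_complexD(5)[OF M] d.neg)
    then show ?thesis
      by (auto simp: coboundaries_def)
  qed
  note mm = module_map_quot_space[OF cochain_complexD(1)[OF K] subspace_coboundaries[OF K]
      cochain_complexD(1)[OF K] subspace_coboundaries[OF K] mixed_complexD(2)[OF M]]
  have "induced (coboundaries M (n - 1)) (Bop M) (class_mod (coboundaries M n) x) =
      class_mod (coboundaries M (n - 1)) (Bop M x)" for n
    by (rule mm(1)[OF *]) (auto intro: cob)
  from this[of "p - 1"]
  show "BV M p (class_mod (coboundaries M (p - 1)) x) = class_mod (coboundaries M (p - 2)) (Bop M x)"
    by (simp add: BV_def Bcoh_def)
  show "module_map (shifted M p) (shifted M (p - 1)) (BV M p)"
    unfolding BV_def Bcoh_def shifted_def cohomology_def by (rule mm(2)[OF * cob])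
qed

section \<open>Negative cyclic cohomology and the maps \<open>j\<close> and \<open>\<beta>\<close>
  on representatives\<close>

lemma CCper_simps:
  "scl (CCper M) c h = (\<lambda>j. scl M c (h j))"
  "dif (CCper M) h = (\<lambda>j. dif M (h j) + Bop M (h (j - 1)))"
  "h \<in> spc (CCper M) n \<longleftrightarrow> (\<forall>j. h j \<in> spc M (n - 2 * j))"
  by (simp_all add: CCper_def uext_def umul_def fun_eq_iff)

lemma vector_space_CCper:
  assumes "vector_space (scl M)"
  shows "vector_space (scl (CCper M))"
proof -
  interpret vector_space "scl M" by fact
  show ?thesis
    by unfold_locales (auto simp: CCper_simps scale_right_distrib scale_left_distrib)
qed

lemma subspace_quot_coboundaries:
  assumes M: "mixed_complex M"
  shows "Modules.module.subspace (scl (CCper M)) (quot_coboundaries (CCper M) (uMu M) n)"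
proof -
  note K = mixed_complexD(1)[OF M]
  interpret d: Vector_Spaces.linear "scl M" "scl M" "dif M"
    using K by (rule cochain_complexD)
  interpret B: Vector_Spaces.linear "scl M" "scl M" "Bop M"
    using M by (rule mixed_complexD)
  interpret V: vector_space "scl (CCper M)"
    by (rule vector_space_CCper[OF cochain_complexD(1)[OF K]])
  have spc: "V.subspace (spc (CCper M) n)" for n
    using cochain_complexD(2)[OF K]
    by (auto simp: V.subspace_def CCper_simps d.vs1.subspace_0 d.vs1.subspace_add d.vs1.subspace_scale)
  then have uMu: "V.subspace (uMu M n)" for n
    by (auto simp: V.subspace_def uMu_def) (auto simp: CCper_simps)
  have "Vector_Spaces.linear (scl (CCper M)) (scl (CCper M)) (dif (CCper M))"
    unfolding Vector_Spaces.linear_iff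
    by (auto simp: V.vector_space_axioms CCper_simps d.add d.scale B.add B.scale
        d.vs1.scale_right_distrib algebra_simps)
  then interpret D: Vector_Spaces.linear "scl (CCper M)" "scl (CCper M)" "dif (CCper M)" .
  \<comment> \<open>A sum of two subspaces: the image of \<open>d_u\<close> and the subcomplex
    divided out.\<close>
  have "quot_coboundaries (CCper M) (uMu M) n = {x + y | x y. x \<in> dif (CCper M) ` spc (CCper M) (n - 1) \<and> y \<in> uMu M n}"
    by (auto simp: quot_coboundaries_def)
  then show ?thesis
    using V.subspace_sums[OF D.subspace_image[OF spc] uMu] by auto
qed

lemma jV_class:
  assumes M: "mixed_complex M"
  shows "jV M p (class_mod (coboundaries M (p - 1)) x) =
    class_mod (quot_coboundaries (CCper M) (uMu M) (p - 1)) (\<lambda>j. if j = 0 then x else 0)"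
proof -
  note K = mixed_complexD(1)[OF M]
  interpret d: Vector_Spaces.linear "scl M" "scl M" "dif M"
    using K by (rule cochain_complexD)
  interpret B: Vector_Spaces.linear "scl M" "scl M" "Bop M"
    using M by (rule mixed_complexD)
  have [simp]: "0 \<in> spc M n" "- y \<in> spc M n \<longleftrightarrow> y \<in> spc M n" for n y
    using cochain_complexD(2)[OF K, of n] d.vs1.subspace_neg[of "spc M n" y] d.vs1.subspace_neg[of "spc M n" "- y"]
    by (auto intro: d.vs1.subspace_0)
  let ?j = "\<lambda>x j::int. if j = 0 then x else 0"
  have "?j w \<in> quot_coboundaries (CCper M) (uMu M) (p - 1)" if "w \<in> coboundaries M (p - 1)" for w
  proof -
    obtain a where a: "w = dif M a" "a \<in> spc M (p - 1 - 1)"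
      using \<open>w \<in> coboundaries M (p - 1)\<close> unfolding coboundaries_def by blast
    \<comment> \<open>On the constant \<open>a\<close>, \<open>d_u\<close> gives
      \<open>b a + u B a\<close>. The correction removes the term in \<open>u\<close>, and it lies
      in the subcomplex divided out.\<close>
    have "?j w = dif (CCper M) (?j a) + (\<lambda>j. if j = 1 then - Bop M a else 0)"
      by (auto simp: fun_eq_iff CCper_simps a d.zero B.zero)
    moreover have "?j a \<in> spc (CCper M) (p - 1 - 1)"
      "(\<lambda>j. if j = 1 then - Bop M a else 0) \<in> uMu M (p - 1)"
      using a mixed_complexD(3)[OF M, of a "p - 2"] by (auto simp: CCper_simps uMu_def)
    ultimately show ?thesis
      unfolding quot_coboundaries_def by blast
  qed
  moreover have "Vector_Spaces.linear (scl M) (scl (CCper M)) ?j"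
    unfolding Vector_Spaces.linear_iff
    using cochain_complexD(1)[OF K] by (auto simp: vector_space_CCper CCper_simps fun_eq_iff)
  ultimately show ?thesis
    unfolding jV_def jmap_def
    \<comment> \<open>Only the formula on representatives is wanted, so \<open>UNIV\<close> stands
      in for both spaces of cocycles.\<close>
    by (intro module_map_quot_space(1)[OF cochain_complexD(1)[OF K] subspace_coboundaries[OF K]
          vector_space_CCper[OF cochain_complexD(1)[OF K]] subspace_quot_coboundaries[OF M], of _ UNIV UNIV]) auto
qed

lemma betaV_class:
  assumes M: "mixed_complex M"
  shows "betaV M p (class_mod (quot_coboundaries (CCper M) (uMu M) (p - 1)) h) =
    class_mod (coboundaries M (p - 2)) (Bop M (h 0))"
proof -
  note K = mixed_complexD(1)[OF M]
  interpret d: Vector_Spaces.linear "scl M" "scl M" "dif M"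
    using K by (rule cochain_complexD)
  interpret B: Vector_Spaces.linear "scl M" "scl M" "Bop M"
    using M by (rule mixed_complexD)
  have "Bop M (w 0) \<in> coboundaries M (p - 1 - 1)" if "w \<in> quot_coboundaries (CCper M) (uMu M) (p - 1)" for w
  proof -
    obtain y v where yv: "w = dif (CCper M) y + v" "y \<in> spc (CCper M) (p - 1 - 1)" "v \<in> uMu M (p - 1)"
      using \<open>w \<in> quot_coboundaries (CCper M) (uMu M) (p - 1)\<close> unfolding quot_coboundaries_def by blast
    then have "y 0 \<in> spc M (p - 1 - 1 - 2 * 0)" "v 0 = 0"
      unfolding CCper_simps uMu_def by blast+
    \<comment> \<open>The constant coefficient of \<open>d_u y + v\<close> is
      \<open>b (y 0) + B (y (-1))\<close>; applying \<open>B\<close> kills the second summand by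
      \<open>B B = 0\<close> and anticommutes with \<open>b\<close> in the first.\<close>
    then have "Bop M (w 0) = dif M (- Bop M (y 0))"
      by (simp add: yv(1) CCper_simps B.add mixed_complexD(4,5)[OF M] d.neg)
    moreover have "- Bop M (y 0) \<in> spc M (p - 1 - 1 - 1)"
      using \<open>y 0 \<in> spc M (p - 1 - 1 - 2 * 0)\<close>
        d.vs1.subspace_neg[OF cochain_complexD(2)[OF K] mixed_complexD(3)[OF M, of "y 0" "p - 1 - 1"]]
      by simp
    ultimately show ?thesis
      by (auto simp: coboundaries_def)
  qed
  moreover have "Vector_Spaces.linear (scl (CCper M)) (scl M) (\<lambda>h. Bop M (h 0))"
    unfolding Vector_Spaces.linear_iff
    using cochain_complexD(1)[OF K] by (auto simp: vector_space_CCper CCper_simps B.add B.scale)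
  ultimately have "betaV M p (class_mod (quot_coboundaries (CCper M) (uMu M) (p - 1)) h) =
    class_mod (coboundaries M (p - 1 - 1)) (Bop M (h 0))"
    unfolding betaV_def betamap_def
    by (intro module_map_quot_space(1)[OF vector_space_CCper[OF cochain_complexD(1)[OF K]]
         subspace_quot_coboundaries[OF M] cochain_complexD(1)[OF K] subspace_coboundaries[OF K], of _ UNIV UNIV]) auto
  then show ?thesis
    by simp
qed

section \<open>The BV identity\<close>

locale palladio_calculus =
  fixes M :: "('k::field, 'm::ab_group_add) mixed_complex"
    and L :: "('k, 'g::ab_group_add) dg_lie_algebra"
    and C :: "('g, 'm) calculus"
    and \<zeta> :: 'm
  assumes mixed: "mixed_complex M"
    and dg_lie: "dg_lie_algebra L"
    and calculus: "homotopy_cartan_gerstenhaber_calculus L M C"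
    and palladio: "palladio_cocycle L M C \<zeta>"
begin

lemmas M_complex = mixed_complexD(1)[OF mixed]

lemma L_complex: "cochain_complex L"
  using dg_lie by (simp add: dg_lie_algebra_def)

lemma cartan: "homotopy_cartan_calculus L M C"
  using calculus by (simp add: homotopy_cartan_gerstenhaber_calculus_def)

lemma pre_cartan: "homotopy_pre_cartan_calculus L M C"
  using cartan by (simp add: homotopy_cartan_calculus_def)

interpretation b: Vector_Spaces.linear "scl M" "scl M" "dif M"
  using M_complex by (rule cochain_complexD)

interpretation B: Vector_Spaces.linear "scl M" "scl M" "Bop M"
  using mixed by (rule mixed_complexD)

interpretation iop: Vector_Spaces.linear "scl M" "scl M" "iop C f" for f
  using pre_cartan by (simp add: homotopy_pre_cartan_calculus_def bilin_def)

interpretation Lop: Vector_Spaces.linear "scl M" "scl M" "Lop C f" for f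
  using pre_cartan by (simp add: homotopy_pre_cartan_calculus_def bilin_def)

interpretation Sop: Vector_Spaces.linear "scl M" "scl M" "Sop C f" for f
  using pre_cartan by (simp add: homotopy_pre_cartan_calculus_def bilin_def)

interpretation Top: Vector_Spaces.linear "scl M" "scl M" "Top C f g" for f g
  using cartan by (simp add: homotopy_cartan_calculus_def bilin_def)

text \<open>For cocycles \<open>f\<close> and \<open>g\<close> of the Lie algebra, this removes the
  terms with \<open>\<delta> f\<close> and \<open>\<delta> g\<close> from the calculus
  identities.\<close>

lemma zero_ops: "iop C 0 m = 0" "Sop C 0 m = 0" "Top C 0 g m = 0" "Top C f 0 m = 0"
proof -
  have lin: "Vector_Spaces.linear (scl L) (scl M) (\<lambda>f. iop C f m)"
    "Vector_Spaces.linear (scl L) (scl M) (\<lambda>f. Sop C f m)"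
    "Vector_Spaces.linear (scl L) (scl M) (\<lambda>f. Top C f g m)"
    "Vector_Spaces.linear (scl L) (scl M) (\<lambda>g. Top C f g m)"
    using pre_cartan cartan
    by (simp_all add: homotopy_pre_cartan_calculus_def homotopy_cartan_calculus_def bilin_def)
  show "iop C 0 m = 0" "Sop C 0 m = 0" "Top C 0 g m = 0" "Top C f 0 m = 0"
    using lin[THEN module_hom.zero[OF Vector_Spaces.linear.axioms(3)]] by auto
qed

lemma scale_sign: "scl M ((- 1) powi n) x = (if even n then x else - x)"
  by (simp add: minus_one_powi)

lemma iop_degree: "f \<in> spc L p \<Longrightarrow> m \<in> spc M q \<Longrightarrow> iop C f m \<in> spc M (p + q + 1)"
  and Sop_degree: "f \<in> spc L p \<Longrightarrow> m \<in> spc M q \<Longrightarrow> Sop C f m \<in> spc M (p + q - 1)"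
  using pre_cartan by (auto simp: homotopy_pre_cartan_calculus_def)

lemma Top_degree:
  "f \<in> spc L p \<Longrightarrow> g \<in> spc L q \<Longrightarrow> m \<in> spc M r \<Longrightarrow> Top C f g m \<in> spc M (p + q + r)"
  using cartan by (auto simp: homotopy_cartan_calculus_def)

lemma dif_iop:
  assumes "f \<in> cocycles L p"
  shows "dif M (iop C f m) = scl M ((- 1) powi (p + 1)) (iop C f (dif M m))"
proof -
  have "gcomm (scl M) 1 (p + 1) (dif M) (iop C f) m + iop C (dif L f) m = 0"
    using pre_cartan assms unfolding homotopy_pre_cartan_calculus_def cocycles_def by blast
  then show ?thesis
    using assms by (simp add: gcomm_def cocycles_def zero_ops)
qed

text \<open>In both graded commutators the Koszul sign is the opposite of \<open>(-1)^p\<close>,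
  since \<open>p + 1\<close> and \<open>p - 1\<close> differ from \<open>p\<close> in parity; hence
  only plus signs appear.\<close>

lemma Lop_cocycle:
  assumes "f \<in> cocycles L p"
  shows "Lop C f m = Bop M (iop C f m) + scl M ((- 1) powi p) (iop C f (Bop M m)) +
    dif M (Sop C f m) + scl M ((- 1) powi p) (Sop C f (dif M m))"
proof -
  have "Lop C f m = gcomm (scl M) (- 1) (p + 1) (Bop M) (iop C f) m
      + gcomm (scl M) 1 (p - 1) (dif M) (Sop C f) m + Sop C (dif L f) m"
    using pre_cartan assms unfolding homotopy_pre_cartan_calculus_def cocycles_def by blast
  then show ?thesis
    using assms by (auto simp: gcomm_def cocycles_def zero_ops scale_sign)
qed

lemma iop_coboundary:
  assumes f: "f \<in> cocycles L p" and w: "w \<in> coboundaries M q" and n: "n = p + q + 1"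
  shows "iop C f w \<in> coboundaries M n"
proof -
  obtain a where a: "w = dif M a" "a \<in> spc M (q - 1)"
    using w unfolding coboundaries_def by blast
  have "iop C f a \<in> spc M (n - 1)"
    using iop_degree[of f p a "q - 1"] f a n by (auto simp: cocycles_def)
  moreover have "iop C f w = scl M ((- 1) powi (p + 1)) (dif M (iop C f a))"
    using dif_iop[OF f, of a] a by (auto simp: scale_sign)
  ultimately show ?thesis
    using b.vs1.subspace_scale[OF subspace_coboundaries[OF M_complex]] by (auto simp: coboundaries_def)
qed

lemma zeta: "\<zeta> \<in> spc M (- 1)" "dif M \<zeta> = 0" "Bop M \<zeta> \<in> coboundaries M (- 2)"
  using palladio by (auto simp: palladio_cocycle_def coboundaries_def)

section \<open>The bracket contracted with \<open>\<zeta>\<close>, up to coboundaries\<close>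

lemma iop_brk_zeta:
  assumes f: "f \<in> cocycles L p" and g: "g \<in> cocycles L q"
  shows "iop C (brk L f g) \<zeta> = iop C f (Lop C g \<zeta>)
    - scl M ((- 1) powi ((p + 1) * q)) (Lop C g (iop C f \<zeta>)) - dif M (Top C f g \<zeta>)"
proof -
  \<comment> \<open>Apply the homotopy formula to the constant \<open>\<zeta>\<close> and compare coefficients of \<open>u\<^sup>0\<close>.\<close>
  let ?h = "\<lambda>j::int. if j = 0 then \<zeta> else 0"
  have "?h \<in> spc (CCper M) (- 1)"
    using zeta(1) b.vs1.subspace_0[OF cochain_complexD(2)[OF M_complex]] by (auto simp: CCper_simps)
  then have "gcomm (scl (CCper M)) (p + 1) q (Iop C f) (uext (Lop C g)) ?h - Iop C (brk L f g) ?h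
        = gcomm (scl (CCper M)) 1 (p + q) (dif (CCper M)) (uext (Top C f g)) ?h
          - uext (Top C (dif L f) g) ?h
          - scl (CCper M) ((- 1) powi p) (uext (Top C f (dif L g)) ?h)"
    using cartan f g unfolding homotopy_cartan_calculus_def cocycles_def by blast
  then have "(gcomm (scl (CCper M)) (p + 1) q (Iop C f) (uext (Lop C g)) ?h - Iop C (brk L f g) ?h) 0
        = (gcomm (scl (CCper M)) 1 (p + q) (dif (CCper M)) (uext (Top C f g)) ?h
          - uext (Top C (dif L f) g) ?h
          - scl (CCper M) ((- 1) powi p) (uext (Top C f (dif L g)) ?h)) 0"
    by (rule arg_cong)
  \<comment> \<open>The parts of \<open>\<I>\<close> and \<open>d_u\<close> that carry a factor
    \<open>u\<close> would read the coefficient of \<open>u^-1\<close>, which is zero for a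
    constant; \<open>b \<zeta> = 0\<close> removes the other half of the commutator with
    \<open>T\<close>.\<close>
  then have "iop C f (Lop C g \<zeta>) - scl M ((- 1) powi ((p + 1) * q)) (Lop C g (iop C f \<zeta>))
      - iop C (brk L f g) \<zeta> = dif M (Top C f g \<zeta>)"
    using f g by (simp add: gcomm_def Iop_def uext_def umul_def CCper_simps cocycles_def zero_ops zeta
        Lop.zero Sop.zero Top.zero B.zero)
  then show ?thesis
    by (simp add: algebra_simps)
qed

text \<open>The BV identity on representatives: after expanding \<open>L_g\<close>, only the terms
  with an outer or middle \<open>B\<close> survive modulo coboundaries.\<close>

lemma iop_brk_zeta_cohomologous:
  assumes f: "f \<in> cocycles L p" and g: "g \<in> cocycles L q"
  shows "iop C (brk L f g) \<zeta> - iop C f (Bop M (iop C g \<zeta>))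
    + scl M ((- 1) powi ((p + 1) * q)) (Bop M (iop C g (iop C f \<zeta>))
        + scl M ((- 1) powi q) (iop C g (Bop M (iop C f \<zeta>)))) \<in> coboundaries M (p + q)"
    (is "?lhs \<in> _")
proof -
  note sub = subspace_coboundaries[OF M_complex, of "p + q"]
  have fg: "f \<in> spc L p" "g \<in> spc L q"
    using f g by (auto simp: cocycles_def)
  have bf: "dif M (iop C f \<zeta>) = 0"
    by (simp add: dif_iop[OF f] zeta iop.zero)
  have bS: "dif M (Sop C g \<zeta>) \<in> coboundaries M (q - 1)"
    using Sop_degree[OF fg(2) zeta(1)] by (auto simp: coboundaries_def)
  \<comment> \<open>The four remainders are the term with \<open>B \<zeta>\<close>, the two terms
    from \<open>[b, S_g]\<close>, and the homotopy \<open>T\<close>. The terms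
    \<open>S_g (b \<zeta>)\<close> and \<open>S_g (b (\<iota>_f \<zeta>))\<close> vanish.\<close>
  have lhs: "?lhs = scl M ((- 1) powi q) (iop C f (iop C g (Bop M \<zeta>))) + iop C f (dif M (Sop C g \<zeta>))
      - scl M ((- 1) powi ((p + 1) * q)) (dif M (Sop C g (iop C f \<zeta>))) - dif M (Top C f g \<zeta>)"
    by (simp add: iop_brk_zeta[OF f g] Lop_cocycle[OF g] bf zeta Sop.zero iop.add iop.scale
        b.vs1.scale_right_distrib)
  show ?thesis
    unfolding lhs
  proof (intro b.vs1.subspace_diff[OF sub] b.vs1.subspace_add[OF sub] b.vs1.subspace_scale[OF sub])
    show "iop C f (iop C g (Bop M \<zeta>)) \<in> coboundaries M (p + q)"
      \<comment> \<open>Here the exactness of \<open>B \<zeta>\<close> enters: contraction with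
        cocycles preserves coboundaries.\<close>
      by (rule iop_coboundary[OF f iop_coboundary[OF g zeta(3)]]) auto
    show "iop C f (dif M (Sop C g \<zeta>)) \<in> coboundaries M (p + q)"
      by (rule iop_coboundary[OF f bS]) auto
    show "dif M (Sop C g (iop C f \<zeta>)) \<in> coboundaries M (p + q)"
      using Sop_degree[OF fg(2) iop_degree[OF fg(1) zeta(1)]]
      by (auto simp: coboundaries_def algebra_simps)
    show "dif M (Top C f g \<zeta>) \<in> coboundaries M (p + q)"
      using Top_degree[OF fg zeta(1)] by (auto simp: coboundaries_def)
  qed
qed

section \<open>The duality isomorphism and the transported operations\<close>

lemma zeta_map_class:
  shows "f \<in> cocycles L n \<Longrightarrow> zeta_map M C \<zeta> n f \<in> cocycles M n"
    and "pmap M C \<zeta> p (class_mod (coboundaries L (p - 1)) f) =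
      class_mod (coboundaries M (p - 1)) (zeta_map M C \<zeta> (p - 1) f)"
    and "module_map (shifted L p) (shifted M p) (pmap M C \<zeta> p)"
    and "bij_betw (pmap M C \<zeta> p) (carrier (shifted L p)) (carrier (shifted M p))"
proof -
  have qi: "quasi_iso L M (zeta_map M C \<zeta>)"
    using palladio by (simp add: palladio_cocycle_def)
  have lin: "Vector_Spaces.linear (scl L) (scl M) (zeta_map M C \<zeta> n)" for n
    using qi by (simp add: quasi_iso_def)
  have *: "zeta_map M C \<zeta> n f \<in> cocycles M n" if "f \<in> cocycles L n" for f n
    using qi that module_hom.zero[OF Vector_Spaces.linear.axioms(3)[OF lin[of "n + 1"]]]
    by (fastforce simp: quasi_iso_def cocycles_def)
  then show "f \<in> cocycles L n \<Longrightarrow> zeta_map M C \<zeta> n f \<in> cocycles M n"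
    by blast
  have cob: "zeta_map M C \<zeta> n w \<in> coboundaries M n" if "w \<in> coboundaries L n" for w n
  proof -
    obtain a where a: "w = dif L a" "a \<in> spc L (n - 1)"
      using \<open>w \<in> coboundaries L n\<close> unfolding coboundaries_def by blast
    \<comment> \<open>\<open>zeta_map\<close> depends on the degree through its sign, so the chain
      map equation is taken at \<open>n - 1\<close> to reach \<open>w\<close> in degree
      \<open>n\<close>.\<close>
    then have "zeta_map M C \<zeta> (n - 1) a \<in> spc M (n - 1)"
      "zeta_map M C \<zeta> (n - 1 + 1) w = dif M (zeta_map M C \<zeta> (n - 1) a)"
      using qi unfolding quasi_iso_def by blast+
    then show ?thesis
      by (auto simp: coboundaries_def)
  qed
  note mm = module_map_quot_space[OF cochain_complexD(1)[OF L_complex] subspace_coboundaries[OF L_complex]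
      cochain_complexD(1)[OF M_complex] subspace_coboundaries[OF M_complex] lin]
  show "pmap M C \<zeta> p (class_mod (coboundaries L (p - 1)) f) =
      class_mod (coboundaries M (p - 1)) (zeta_map M C \<zeta> (p - 1) f)"
    unfolding pmap_def by (rule mm(1)[OF *]) (auto intro: cob)
  show "module_map (shifted L p) (shifted M p) (pmap M C \<zeta> p)"
    unfolding pmap_def shifted_def cohomology_def by (rule mm(2)[OF *]) (auto intro: cob)
  show "bij_betw (pmap M C \<zeta> p) (carrier (shifted L p)) (carrier (shifted M p))"
    using qi unfolding pmap_def shifted_def quasi_iso_def by blast
qed

lemma pinv_class:
  assumes "f \<in> cocycles L (p - 1)"
  shows "pinv L M C \<zeta> p (class_mod (coboundaries M (p - 1)) (zeta_map M C \<zeta> (p - 1) f)) =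
    class_mod (coboundaries L (p - 1)) f"
proof -
  have "class_mod (coboundaries L (p - 1)) f \<in> carrier (shifted L p)"
    using assms by (auto simp: shifted_simps[OF L_complex])
  then show ?thesis
    unfolding pinv_def zeta_map_class(2)[symmetric]
    using bij_betw_inv_into_left[OF zeta_map_class(4)] by blast
qed

text \<open>Surjectivity of \<open>p_\<zeta>\<close>: every class of \<open>V\<close> has a
  representative of the form \<open>\<iota>_f \<zeta>\<close> up to sign, which brings computations
  in \<open>V\<close> back to contractions.\<close>

lemma shifted_cases:
  assumes "x \<in> carrier (shifted M p)"
  obtains f where "f \<in> cocycles L (p - 1)"
    and "x = class_mod (coboundaries M (p - 1)) (zeta_map M C \<zeta> (p - 1) f)"
proof -
  obtain X where "X \<in> carrier (shifted L p)" "x = pmap M C \<zeta> p X"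
    using assms zeta_map_class(4)[of p] by (auto simp: bij_betw_def)
  then show thesis
    using that by (auto simp: shifted_simps[OF L_complex] zeta_map_class(2))
qed

lemma brkV_zeta:
  assumes f: "f \<in> cocycles L (p - 1)" and g: "g \<in> cocycles L (q - 1)"
  shows "brkV L M C \<zeta> p q (class_mod (coboundaries M (p - 1)) (zeta_map M C \<zeta> (p - 1) f))
      (class_mod (coboundaries M (q - 1)) (zeta_map M C \<zeta> (q - 1) g)) =
    class_mod (coboundaries M (p + q - 2)) (zeta_map M C \<zeta> (p + q - 2) (brk L f g))"
proof -
  have "brkG L p q (class_mod (coboundaries L (p - 1)) f) (class_mod (coboundaries L (q - 1)) g) =
      class_mod (coboundaries L (p + q - 2)) (brk L f g)"
    unfolding brkG_def
  proof (rule induced2_cohomology(2)[OF L_complex _ _ _ f g, where d = 0 and e = 0])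
    show "bilin (scl L) (scl L) (scl L) (brk L)"
      using dg_lie by (simp add: dg_lie_algebra_def)
    fix r s x y assume "x \<in> spc L r" "y \<in> spc L s"
    then have "brk L x y \<in> spc L (r + s)"
      "dif L (brk L x y) = brk L (dif L x) y + scl L ((- 1) powi r) (brk L x (dif L y))"
      using dg_lie unfolding dg_lie_algebra_def by blast+
    then show "brk L x y \<in> spc L (r + s + 0)"
      "dif L (brk L x y) = brk L (dif L x) y + scl L ((- 1) powi (r + 0)) (brk L x (dif L y))"
      by simp_all
  qed simp
  then show ?thesis
    using zeta_map_class(2)[of "p + q - 1"] by (simp add: brkV_def pinv_class f g)
qed

text \<open>Multiplication by the class of \<open>f\<close> is contraction with \<open>f\<close>,
  because \<open>\<iota>\<close> is multiplicative. Allowing an arbitrary cocycle \<open>y\<close>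
  on the right lets the formula be applied to \<open>B Y\<close>.\<close>

lemma cupV_class:
  assumes f: "f \<in> cocycles L (p - 1)" and y: "y \<in> cocycles M (q - 1)"
  shows "cupV L M C \<zeta> p q (class_mod (coboundaries M (p - 1)) (zeta_map M C \<zeta> (p - 1) f))
      (class_mod (coboundaries M (q - 1)) y) =
    class_mod (coboundaries M (p + q - 1)) (scl M ((- 1) powi p) (iop C f y))"
proof -
  have "class_mod (coboundaries M (q - 1)) y \<in> carrier (shifted M q)"
    using y by (auto simp: shifted_simps[OF M_complex])
  then obtain g where g: "g \<in> cocycles L (q - 1)"
    and yg: "class_mod (coboundaries M (q - 1)) y = class_mod (coboundaries M (q - 1)) (zeta_map M C \<zeta> (q - 1) g)"
    by (rule shifted_cases)
  \<comment> \<open>\<open>y\<close> differs by a coboundary from a contraction of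
    \<open>\<zeta>\<close>, and \<open>\<iota>_f\<close> sends this difference to a
    coboundary.\<close>
  then have "zeta_map M C \<zeta> (q - 1) g - y \<in> coboundaries M (q - 1)"
    using shifted_simps(5)[OF M_complex] by metis
  then have *: "iop C f (zeta_map M C \<zeta> (q - 1) g - y) \<in> coboundaries M (p + q - 1)"
    by (rule iop_coboundary[OF f]) simp
  have "cupG L C p q (class_mod (coboundaries L (p - 1)) f) (class_mod (coboundaries L (q - 1)) g) =
      class_mod (coboundaries L (p + q - 1)) (cup C f g)"
    unfolding cupG_def using calculus
    by (intro induced2_cohomology(2)[OF L_complex _ _ _ f g, where d = 1 and e = 1])
      (auto simp: homotopy_cartan_gerstenhaber_calculus_def)
  then have "cupV L M C \<zeta> p q (class_mod (coboundaries M (p - 1)) (zeta_map M C \<zeta> (p - 1) f))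
      (class_mod (coboundaries M (q - 1)) y) =
    class_mod (coboundaries M (p + q - 1)) (zeta_map M C \<zeta> (p + q - 1) (cup C f g))"
    using zeta_map_class(2)[of "p + q"] by (simp add: cupV_def pinv_class f g yg)
  \<comment> \<open>The sign splits as \<open>(-1)^(p+q-1) = (-1)^p (-1)^(q-1)\<close>, and the
    second factor is the one inside \<open>zeta_map\<close> of \<open>g\<close>.\<close>
  also have "zeta_map M C \<zeta> (p + q - 1) (cup C f g) =
      scl M ((- 1) powi p) (iop C f (zeta_map M C \<zeta> (q - 1) g))"
    using calculus
    by (auto simp: homotopy_cartan_gerstenhaber_calculus_def zeta_map_def scale_sign iop.neg)
  also have "class_mod (coboundaries M (p + q - 1)) \<dots> =
      class_mod (coboundaries M (p + q - 1)) (scl M ((- 1) powi p) (iop C f y))"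
    using b.vs1.subspace_scale[OF subspace_coboundaries[OF M_complex] *, of "(- 1) powi p"]
    by (simp add: shifted_simps(5)[OF M_complex] iop.diff b.vs1.scale_right_diff_distrib)
  finally show ?thesis .
qed

lemma graded_comm_algebra_cupV:
  assumes "graded_comm_algebra (shifted L) (cupG L C)"
  shows "graded_comm_algebra (shifted M) (cupV L M C \<zeta>)"
proof -
  have "cupV L M C \<zeta> = (\<lambda>p q x y. pmap M C \<zeta> (p + q) (cupG L C p q
      (inv_into (carrier (shifted L p)) (pmap M C \<zeta> p) x)
      (inv_into (carrier (shifted L q)) (pmap M C \<zeta> q) y)))"
    by (intro ext) (simp add: cupV_def pinv_def)
  moreover have "Module.module field_ring (shifted M n)" for n
    unfolding shifted_def by (rule cohomology_module[OF M_complex])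
  ultimately show ?thesis
    using graded_comm_algebra_transport[OF assms _ zeta_map_class(3,4)] by simp
qed

text \<open>The BV identity is used for the pair \<open>(g, f)\<close>, that is, for the bracket of
  \<open>y\<close> with \<open>x\<close>: in this order it contains
  \<open>B (\<iota>_f (\<iota>_g \<zeta>))\<close>, which represents \<open>B (x \<smile> y)\<close>
  up to sign.\<close>

lemma BV_derivation:
  assumes comm: "graded_comm_algebra (shifted M) (cupV L M C \<zeta>)"
    and vanish: "brkV L M C \<zeta> q p y x = \<zero>\<^bsub>shifted M (q + p - 1)\<^esub>"
    and x: "x \<in> carrier (shifted M p)" and y: "y \<in> carrier (shifted M q)"
  shows "BV M (p + q) (cupV L M C \<zeta> p q x y) =
    cupV L M C \<zeta> (p - 1) q (BV M p x) y \<oplus>\<^bsub>shifted M (p + q - 1)\<^esub>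
    (- 1) powi p \<odot>\<^bsub>shifted M (p + q - 1)\<^esub> cupV L M C \<zeta> p (q - 1) x (BV M q y)"
proof -
  obtain f where f: "f \<in> cocycles L (p - 1)"
    and x_def: "x = class_mod (coboundaries M (p - 1)) (zeta_map M C \<zeta> (p - 1) f)"
    using x by (rule shifted_cases)
  obtain g where g: "g \<in> cocycles L (q - 1)"
    and y_def: "y = class_mod (coboundaries M (q - 1)) (zeta_map M C \<zeta> (q - 1) g)"
    using y by (rule shifted_cases)
  define X where "X = zeta_map M C \<zeta> (p - 1) f"
  define Y where "Y = zeta_map M C \<zeta> (q - 1) g"
  let ?n = "p + q - 2"
  have X: "X \<in> cocycles M (p - 1)" "Bop M X \<in> cocycles M (p - 1 - 1)"
    and Y: "Y \<in> cocycles M (q - 1)" "Bop M Y \<in> cocycles M (q - 1 - 1)"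
    unfolding X_def Y_def using f g by (blast intro: zeta_map_class(1) BV_class(1)[OF mixed])+
  have n: "p + q - 1 - 1 = ?n" "p + (q - 1) - 1 = ?n" "q + (p - 1) - 1 = ?n"
    by auto
  have By: "BV M q y = class_mod (coboundaries M (q - 1 - 1)) (Bop M Y)"
    and Bx: "BV M p x = class_mod (coboundaries M (p - 1 - 1)) (Bop M X)"
    by (simp_all add: x_def y_def X_def Y_def BV_class(2)[OF mixed])
  have "cupV L M C \<zeta> p q x y = class_mod (coboundaries M (p + q - 1)) (scl M ((- 1) powi p) (iop C f Y))"
    unfolding x_def y_def Y_def[symmetric] by (rule cupV_class[OF f Y(1)])
  then have 1: "BV M (p + q) (cupV L M C \<zeta> p q x y) =
      class_mod (coboundaries M ?n) (scl M ((- 1) powi p) (Bop M (iop C f Y)))"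
    by (simp add: BV_class(2)[OF mixed] B.scale)
  have 2: "cupV L M C \<zeta> p (q - 1) x (BV M q y) =
      class_mod (coboundaries M ?n) (scl M ((- 1) powi p) (iop C f (Bop M Y)))"
    unfolding x_def By using cupV_class[OF f Y(2)] by (simp only: n)
  \<comment> \<open>\<open>cupV_class\<close> needs a left factor given by a Lie algebra cocycle,
    and none is at hand for \<open>B x\<close>. So \<open>y \<smile> B x\<close> is computed and
    then commuted.\<close>
  have "cupV L M C \<zeta> q (p - 1) y (BV M p x) =
      class_mod (coboundaries M ?n) (scl M ((- 1) powi q) (iop C g (Bop M X)))"
    unfolding y_def Bx using cupV_class[OF g X(2)] by (simp only: n)
  moreover have "cupV L M C \<zeta> (p - 1) q (BV M p x) y =
      (- 1) powi ((p - 1) * q) \<odot>\<^bsub>shifted M (p + q - 1)\<^esub> cupV L M C \<zeta> q (p - 1) y (BV M p x)"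
    using graded_comm_algebraD(3)[OF comm module_mapD(1)[OF BV_class(3)[OF mixed] x] y]
    by (simp add: algebra_simps)
  ultimately have 3: "cupV L M C \<zeta> (p - 1) q (BV M p x) y = class_mod (coboundaries M ?n)
      (scl M ((- 1) powi ((p - 1) * q)) (scl M ((- 1) powi q) (iop C g (Bop M X))))"
    using shifted_simps(3)[OF M_complex, where n = "p + q - 1"] by (simp add: n)
  note sub = subspace_coboundaries[OF M_complex, of ?n]
  have n': "q + p - 2 = ?n" "q - 1 + (p - 1) = ?n" "q + p - 1 - 1 = ?n"
    by auto
  have "zeta_map M C \<zeta> ?n (brk L g f) \<in> coboundaries M ?n"
    using vanish brkV_zeta[OF g f] shifted_simps(4)[OF M_complex, where n = "q + p - 1"]
      shifted_simps(5)[OF M_complex, where n = ?n and y = 0]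
    unfolding x_def y_def n' by simp
  \<comment> \<open>The sign in \<open>zeta_map\<close> is stripped off; a subspace is closed under
    negation.\<close>
  then have "iop C (brk L g f) \<zeta> \<in> coboundaries M ?n"
    using b.vs1.subspace_neg[OF sub, of "- iop C (brk L g f) \<zeta>"]
    by (auto simp: zeta_map_def scale_sign split: if_splits)
  from b.vs1.subspace_diff[OF sub iop_brk_zeta_cohomologous[OF g f, unfolded n'] this]
  have K: "scl M ((- 1) powi (q * (p - 1))) (Bop M (iop C f (iop C g \<zeta>))
        + scl M ((- 1) powi (p - 1)) (iop C f (Bop M (iop C g \<zeta>))))
        - iop C g (Bop M (iop C f \<zeta>)) \<in> coboundaries M ?n" (is "?K \<in> _")
    by (simp add: algebra_simps)
  \<comment> \<open>On representatives the failure of the derivation rule is exactly a sign times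
    \<open>?K\<close>, hence a coboundary.\<close>
  have "scl M ((- 1) powi p) (Bop M (iop C f Y)) -
      (scl M ((- 1) powi ((p - 1) * q)) (scl M ((- 1) powi q) (iop C g (Bop M X))) +
       scl M ((- 1) powi p) (scl M ((- 1) powi p) (iop C f (Bop M Y)))) =
    scl M ((- 1) powi (p * q + p - 1)) ?K"
    by (auto simp: X_def Y_def zeta_map_def scale_sign iop.neg B.neg algebra_simps)
  then show ?thesis
    unfolding 1 2 3
    using shifted_simps(2,3)[OF M_complex, where n = "p + q - 1"] b.vs1.subspace_scale[OF sub K]
    by (simp add: shifted_simps(5)[OF M_complex] n)
qed

end

theorem corollaryE:
  fixes M :: "('k::field_char_0, 'm::ab_group_add) mixed_complex"
    and L :: "('k, 'g::ab_group_add) dg_lie_algebra"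
    and C :: "('g, 'm) calculus"
    and \<zeta> :: 'm
  assumes "mixed_complex M"
    and "dg_lie_algebra L"
    and "homotopy_cartan_gerstenhaber_calculus L M C"
    and "palladio_cocycle L M C \<zeta>"
    and "gerstenhaber_algebra (shifted L) (cupG L C) (brkG L)"
    and "\<forall>p q. \<forall>x\<in>carrier (shifted M p). \<forall>y\<in>carrier (shifted M q).
           brkV L M C \<zeta> p q x y = \<zero>\<^bsub>shifted M (p + q - 1)\<^esub>"
  shows "lie_bracket_deg_minus_2 (shifted M) (e3_bracket L M C \<zeta>) \<and>
     (\<forall>p q. \<forall>x\<in>carrier (shifted M p). \<forall>y\<in>carrier (shifted M q).
        jV M (p + q - 2) (e3_bracket L M C \<zeta> p q x y)
          = csm_bracket L M C \<zeta> p q (jV M p x) (jV M q y) \<and>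
        BV M (p + q - 2) (e3_bracket L M C \<zeta> p q x y) = \<zero>\<^bsub>shifted M (p + q - 3)\<^esub>) \<and>
     e3_algebra (shifted M) (cupV L M C \<zeta>) (e3_bracket L M C \<zeta>)"
proof -
  interpret palladio_calculus M L C \<zeta>
    using assms(1-4) by unfold_locales
  interpret M: vector_space "scl M"
    by (rule cochain_complexD(1)[OF M_complex])
  have comm: "graded_comm_algebra (shifted M) (cupV L M C \<zeta>)"
    using assms(5) by (intro graded_comm_algebra_cupV) (simp add: gerstenhaber_algebra_def)
  have BB: "BV M (p - 1) (BV M p x) = \<zero>\<^bsub>shifted M (p - 2)\<^esub>" if "x \<in> carrier (shifted M p)" for p x
    using that BV_class(2)[OF mixed, of p] BV_class(2)[OF mixed, of "p - 1"]
    by (auto simp: shifted_simps(1)[OF M_complex] shifted_simps(4)[OF M_complex, of "p - 2"]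
        mixed_complexD(4)[OF mixed])
  have der: "BV M (p + q) (cupV L M C \<zeta> p q x y) =
      cupV L M C \<zeta> (p - 1) q (BV M p x) y \<oplus>\<^bsub>shifted M (p + q - 1)\<^esub>
      (- 1) powi p \<odot>\<^bsub>shifted M (p + q - 1)\<^esub> cupV L M C \<zeta> p (q - 1) x (BV M q y)"
    if "x \<in> carrier (shifted M p)" "y \<in> carrier (shifted M q)" for p q x y
    using that assms(6) by (intro BV_derivation comm) auto
  note e3 = e3_algebra_of_derivation[OF comm BV_class(3)[OF mixed] BB der e3_bracket_def]
  have j: "jV M (p + q - 2) (e3_bracket L M C \<zeta> p q x y) = csm_bracket L M C \<zeta> p q (jV M p x) (jV M q y)"
    if xy: "x \<in> carrier (shifted M p)" "y \<in> carrier (shifted M q)" for p q x y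
  proof -
    \<comment> \<open>\<open>j\<close> embeds \<open>x\<close> as a constant series, whose
      coefficient of \<open>u^0\<close> is \<open>x\<close> again.\<close>
    have beta_j: "betaV M r (jV M r z) = BV M r z" if "z \<in> carrier (shifted M r)" for r z
      using that by (auto simp: shifted_simps(1)[OF M_complex] jV_class[OF mixed] betaV_class[OF mixed]
          BV_class(2)[OF mixed])
    have "cupV L M C \<zeta> (p - 1) (q - 1) (BV M p x) (BV M q y) \<in> carrier (shifted M (p - 1 + (q - 1) + 0))"
      using graded_bilinearD(1)[OF graded_comm_algebraD(2)[OF comm]]
        module_mapD(1)[OF BV_class(3)[OF mixed]] xy by blast
    \<comment> \<open>The degree is written \<open>p + q - 2 - 1\<close> to fit the formulas for
      \<open>j\<close> and for scaling at shifted degree \<open>p + q - 2\<close>.\<close>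
    then obtain v where v: "cupV L M C \<zeta> (p - 1) (q - 1) (BV M p x) (BV M q y) =
        class_mod (coboundaries M (p + q - 2 - 1)) v"
      by (auto simp: shifted_simps(1)[OF M_complex])
    have "vector_space (scl (CCper M))"
      by (rule vector_space_CCper[OF cochain_complexD(1)[OF M_complex]])
    \<comment> \<open>Hence \<open>j\<close> commutes with the sign \<open>(-1)^p\<close>, the only
      difference left between the two sides.\<close>
    moreover have "(\<lambda>j. if j = 0 then scl M c v else 0) = scl (CCper M) c (\<lambda>j. if j = 0 then v else 0)" for c
      by (auto simp: CCper_simps M.scale_zero_right)
    ultimately show ?thesis
      unfolding e3_bracket_def csm_bracket_def beta_j[OF xy(1)] beta_j[OF xy(2)] v
        shifted_simps(3)[OF M_complex] jV_class[OF mixed] HCshift_def HCneg_def quot_cohomology_def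
      by (simp only: quot_space_simps(2) subspace_quot_coboundaries[OF mixed])
  qed
  show ?thesis
    using e3 j by blast
qed

end
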